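(* For every $(A,B,C,D)\in\mathbb{C}^4$ the Julia set $\mathcal{J}_{A,B,C,D}$ is connected.
   Context: For $(A,B,C,D)\in\mathbb{C}^4$ let $S_{A,B,C,D}=\{(x,y,z)\in\mathbb{C}^3: x^2+y^2+z^2+xyz=Ax+By+Cz+D\}$. The involutions $s_x(x,y,z)=(-x-yz+A,\,y,\,z)$, $s_y(x,y,z)=(x,\,-y-xz+B,\,z)$, $s_z(x,y,z)=(x,\,y,\,-z-xy+C)$ preserve $S_{A,B,C,D}$. Let $\mathcal{G}_{A,B,C,D}=\langle g_x,g_y,g_z\rangle$ be the group of automorphisms of $S_{A,B,C,D}$ generated by $g_x=s_z\circ s_y$, $g_y=s_x\circ s_z$, $g_z=s_y\circ s_x$. A sequence of maps $f_i$ converges to infinity on an open set $U\subset S_{A,B,C,D}$ if for every compact $\overline V\subset U$ and every compact $K\subset S_{A,B,C,D}$ only finitely many $i$ satisfy $f_i(\overline V)\cap K\neq\emptyset$. The group $\mathcal{G}_{A,B,C,D}$ forms a normal family on $U$ if every sequence of its elements has a subsequence that, on $U$, either converges uniformly on compact subsets or converges to infinity. The Fatou set $\mathcal{F}_{A,B,C,D}$ is the set of $p\in S_{A,B,C,D}$ having an open neighborhood on which $\mathcal{G}_{A,B,C,D}$ forms a normal family; the Julia set is $\mathcal{J}_{A,B,C,D}=S_{A,B,C,D}\setminus\mathcal{F}_{A,B,C,D}$. *)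

theory Defs
  imports
    "HOL-Analysis.Analysis"
    "HOL-Algebra.Bij"
    "HOL-Algebra.Generated_Groups"
begin

definition surface :: "complex \<Rightarrow> complex \<Rightarrow> complex \<Rightarrow> complex \<Rightarrow> (complex \<times> complex \<times> complex) set" where
  "surface A B C D = {(x, y, z). x^2 + y^2 + z^2 + x * y * z = A * x + B * y + C * z + D}"

definition s_x :: "complex \<Rightarrow> complex \<times> complex \<times> complex \<Rightarrow> complex \<times> complex \<times> complex" where
  "s_x A = (\<lambda>(x, y, z). (- x - y * z + A, y, z))"

definition s_y :: "complex \<Rightarrow> complex \<times> complex \<times> complex \<Rightarrow> complex \<times> complex \<times> complex" where
  "s_y B = (\<lambda>(x, y, z). (x, - y - x * z + B, z))"

definition s_z :: "complex \<Rightarrow> complex \<times> complex \<times> complex \<Rightarrow> complex \<times> complex \<times> complex" where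
  "s_z C = (\<lambda>(x, y, z). (x, y, - z - x * y + C))"

definition g_x :: "complex \<Rightarrow> complex \<Rightarrow> complex \<Rightarrow> complex \<times> complex \<times> complex \<Rightarrow> complex \<times> complex \<times> complex" where
  "g_x A B C = s_z C \<circ> s_y B"

definition g_y :: "complex \<Rightarrow> complex \<Rightarrow> complex \<Rightarrow> complex \<times> complex \<times> complex \<Rightarrow> complex \<times> complex \<times> complex" where
  "g_y A B C = s_x A \<circ> s_z C"

definition g_z :: "complex \<Rightarrow> complex \<Rightarrow> complex \<Rightarrow> complex \<times> complex \<times> complex \<Rightarrow> complex \<times> complex \<times> complex" where
  "g_z A B C = s_y B \<circ> s_x A"

text \<open>The elements of the group are maps of the surface, so the generators are restricted to it;
  following the convention of \<^const>\<open>BijGroup\<close>, they are undefined off the surface.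
  That the generators do belong to \<^const>\<open>BijGroup\<close> is shown in \<open>generators_in_BijGroup\<close>.\<close>

definition generators ::
    "complex \<Rightarrow> complex \<Rightarrow> complex \<Rightarrow> complex \<Rightarrow> (complex \<times> complex \<times> complex \<Rightarrow> complex \<times> complex \<times> complex) set" where
  "generators A B C D =
     (\<lambda>g. restrict g (surface A B C D)) ` {g_x A B C, g_y A B C, g_z A B C}"

definition aut_group ::
    "complex \<Rightarrow> complex \<Rightarrow> complex \<Rightarrow> complex \<Rightarrow> (complex \<times> complex \<times> complex \<Rightarrow> complex \<times> complex \<times> complex) set" where
  "aut_group A B C D = generate (BijGroup (surface A B C D)) (generators A B C D)"

definition converges_to_infinity_on ::
    "'a::metric_space set \<Rightarrow> (nat \<Rightarrow> 'a \<Rightarrow> 'a) \<Rightarrow> 'a set \<Rightarrow> bool" where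
  "converges_to_infinity_on S f U \<longleftrightarrow>
     (\<forall>V K. compact V \<and> V \<subseteq> U \<and> compact K \<and> K \<subseteq> S \<longrightarrow> finite {i. f i ` V \<inter> K \<noteq> {}})"

text \<open>The limit map is not required to take values in \<open>S\<close>: for maps of \<open>S\<close> into itself
  this is automatic when \<open>S\<close> is closed, as the surfaces are.\<close>

definition converges_uniformly_on_compacts ::
    "(nat \<Rightarrow> 'a \<Rightarrow> 'a) \<Rightarrow> 'a::metric_space set \<Rightarrow> bool" where
  "converges_uniformly_on_compacts f U \<longleftrightarrow>
     (\<exists>h. \<forall>V. compact V \<and> V \<subseteq> U \<longrightarrow> uniform_limit V f h sequentially)"

definition normal_family_on ::
    "'a::metric_space set \<Rightarrow> ('a \<Rightarrow> 'a) set \<Rightarrow> 'a set \<Rightarrow> bool" where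
  "normal_family_on S F U \<longleftrightarrow>
     (\<forall>f :: nat \<Rightarrow> 'a \<Rightarrow> 'a. range f \<subseteq> F \<longrightarrow>
        (\<exists>r. strict_mono r \<and>
           (converges_uniformly_on_compacts (f \<circ> r) U \<or> converges_to_infinity_on S (f \<circ> r) U)))"

definition fatou_set :: "complex \<Rightarrow> complex \<Rightarrow> complex \<Rightarrow> complex \<Rightarrow> (complex \<times> complex \<times> complex) set" where
  "fatou_set A B C D =
     {p \<in> surface A B C D.
        \<exists>U. openin (top_of_set (surface A B C D)) U \<and> p \<in> U \<and>
            normal_family_on (surface A B C D) (aut_group A B C D) U}"

definition julia_set :: "complex \<Rightarrow> complex \<Rightarrow> complex \<Rightarrow> complex \<Rightarrow> (complex \<times> complex \<times> complex) set" where
  "julia_set A B C D = surface A B C D - fatou_set A B C D"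

lemma s_x_surface: "p \<in> surface A B C D \<Longrightarrow> s_x A p \<in> surface A B C D"
  and s_y_surface: "p \<in> surface A B C D \<Longrightarrow> s_y B p \<in> surface A B C D"
  and s_z_surface: "p \<in> surface A B C D \<Longrightarrow> s_z C p \<in> surface A B C D"
  by (auto simp: surface_def s_x_def s_y_def s_z_def power2_eq_square algebra_simps)

lemma s_x_s_x: "s_x A (s_x A p) = p"
  and s_y_s_y: "s_y B (s_y B p) = p"
  and s_z_s_z: "s_z C (s_z C p) = p"
  by (auto simp: s_x_def s_y_def s_z_def split: prod.splits)

lemma bij_betw_s_x: "bij_betw (s_x A) (surface A B C D) (surface A B C D)"
  by (rule bij_betw_byWitness[where f' = "s_x A"]) (auto simp: s_x_s_x s_x_surface)

lemma bij_betw_s_y: "bij_betw (s_y B) (surface A B C D) (surface A B C D)"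
  by (rule bij_betw_byWitness[where f' = "s_y B"]) (auto simp: s_y_s_y s_y_surface)

lemma bij_betw_s_z: "bij_betw (s_z C) (surface A B C D) (surface A B C D)"
  by (rule bij_betw_byWitness[where f' = "s_z C"]) (auto simp: s_z_s_z s_z_surface)

lemma generators_in_BijGroup: "generators A B C D \<subseteq> carrier (BijGroup (surface A B C D))"
proof -
  have "bij_betw g (surface A B C D) (surface A B C D)"
    if "g \<in> {g_x A B C, g_y A B C, g_z A B C}" for g
    using that bij_betw_s_x[of A B C D] bij_betw_s_y[of B A C D] bij_betw_s_z[of C A B D]
    by (auto simp: g_x_def g_y_def g_z_def intro: bij_betw_trans)
  then show ?thesis
    by (auto simp: generators_def BijGroup_def Bij_def)
qed

lemma subgroup_aut_group: "subgroup (aut_group A B C D) (BijGroup (surface A B C D))"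
  unfolding aut_group_def
  by (rule group.generate_is_subgroup[OF group_BijGroup generators_in_BijGroup])

end

theory Submission
  imports Defs "HOL-Complex_Analysis.Great_Picard"
begin

text \<open>Let \<open>E\<close> be the set of points of the surface with some coordinate in the real interval
  \<open>(-2, 2)\<close>. The Julia set is the closure of the orbit of \<open>E\<close> under the group, and that orbit is
  connected: \<open>E\<close> is connected, and \<open>s_z \<circ> s_y\<close> preserves the part of \<open>E\<close> with \<open>x \<in> (-2, 2)\<close>, so
  the images of \<open>E\<close> under the prefixes of a word in the generators form a chain.

  Points of \<open>E\<close> are in the Julia set because \<open>s_z \<circ> s_y\<close> acts on a conic \<open>x = const\<close> as an affine
  map, elliptic for \<open>x \<in> (-2, 2)\<close> and hyperbolic for nearby non-real \<open>x\<close>. Conversely, on an open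
  set disjoint from the orbit all coordinates of all group elements omit \<open>0\<close> and \<open>1\<close>, so Schottky's
  theorem gives normality near each smooth point. Singular points always lie in the closure of the
  orbit, so no function theory on a singular surface is needed.\<close>

subsection \<open>The automorphism group\<close>

text \<open>On the conic \<open>x = const\<close> the eigenvalues of \<open>s_z \<circ> s_y\<close>
  are unimodular exactly when \<open>x\<close> is real with absolute value at most 2. The endpoints
  are left out of the interval because there both eigenvalues are 1 and the conic may have no
  centre.

  Normality concerns maps of a possibly singular surface in three variables, Schottky's theorem
  functions of one variable. The gap is bridged by holomorphic discs in the surface that join any
  two points near a smooth point, with a parameter controlled by the distance of the points. The
  resulting estimate depends only on the size of a group element at one point, and this size decides
  between the two alternatives of normality: bounded values give a convergent subsequence, unbounded
  ones give escape.

  Most arguments treat a single coordinate. The cyclic permutation \<open>rot\<close>, which also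
  permutes the parameters \<open>A\<close>, \<open>B\<close>, \<open>C\<close>, carries them to the
  other two.\<close>

definition rot :: "complex \<times> complex \<times> complex \<Rightarrow> complex \<times> complex \<times> complex" where
  "rot = (\<lambda>(x, y, z). (y, z, x))"

lemma rot_surface: "rot p \<in> surface B C A D \<longleftrightarrow> p \<in> surface A B C D"
  by (cases p) (auto simp: rot_def surface_def algebra_simps)

lemma rot_s_x: "rot (s_x A p) = s_z A (rot p)"
  and rot_s_y: "rot (s_y B p) = s_x B (rot p)"
  and rot_s_z: "rot (s_z C p) = s_y C (rot p)"
  by (cases p; simp add: rot_def s_x_def s_y_def s_z_def mult.commute)+

lemma rot_rot_rot [simp]: "rot (rot (rot p)) = p"
  by (cases p) (simp add: rot_def)

lemma norm_rot [simp]: "norm (rot p) = norm p"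
  by (cases p) (simp add: rot_def norm_Pair add.commute add.left_commute)

lemma rot_diff: "rot p - rot q = rot (p - q)"
  by (cases p; cases q) (simp add: rot_def)

lemma dist_rot [simp]: "dist (rot p) (rot q) = dist p q"
  by (simp add: dist_norm rot_diff)

lemma continuous_on_rot [continuous_intros]: "continuous_on T rot"
  unfolding rot_def case_prod_unfold by (intro continuous_intros)

lemma rot_sel [simp]: "fst (rot p) = fst (snd p)" "fst (snd (rot p)) = snd (snd p)" "snd (snd (rot p)) = fst p"
  by (simp_all add: rot_def case_prod_unfold)

text \<open>The three generators and their inverses as total maps of the ambient space; iteration,
  continuity and the preserved coordinate are read off more easily than from the restricted
  maps.\<close>

definition moves :: "complex \<Rightarrow> complex \<Rightarrow> complex \<Rightarrow> (complex \<times> complex \<times> complex \<Rightarrow> complex \<times> complex \<times> complex) set" where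
  "moves A B C = {s_z C \<circ> s_y B, s_x A \<circ> s_z C, s_y B \<circ> s_x A, s_y B \<circ> s_z C, s_z C \<circ> s_x A, s_x A \<circ> s_y B}"

lemma restrict_generators:
  "restrict (s_z C \<circ> s_y B) (surface A B C D) \<in> generators A B C D"
  "restrict (s_x A \<circ> s_z C) (surface A B C D) \<in> generators A B C D"
  "restrict (s_y B \<circ> s_x A) (surface A B C D) \<in> generators A B C D"
  by (auto simp: generators_def g_x_def g_y_def g_z_def)

lemma moves_surface:
  assumes "h \<in> moves A B C" "p \<in> surface A B C D"
  shows "h p \<in> surface A B C D"
  using assms by (auto simp: moves_def intro!: s_x_surface s_y_surface s_z_surface)

lemma bij_betw_moves:
  assumes "h \<in> moves A B C"
  shows "bij_betw h (surface A B C D) (surface A B C D)"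
  using assms bij_betw_s_x[of A B C D] bij_betw_s_y[of B A C D] bij_betw_s_z[of C A B D]
  by (auto simp: moves_def intro: bij_betw_trans)

lemma inv_restrict_BijGroup:
  assumes "bij_betw h S S" "\<And>p. p \<in> S \<Longrightarrow> k p \<in> S" "\<And>p. p \<in> S \<Longrightarrow> k (h p) = p"
  shows "inv\<^bsub>BijGroup S\<^esub> (restrict h S) = restrict k S"
proof (rule ext)
  fix p
  have hB: "restrict h S \<in> Bij S"
    using assms(1) by (auto simp: Bij_def)
  have "inv_into S (restrict h S) p = k p" if "p \<in> S"
  proof -
    have "p \<in> h ` S"
      using that by (simp add: bij_betw_imp_surj_on[OF assms(1)])
    then obtain q where "q \<in> S" "p = h q" by blast
    moreover have "inv_into S (restrict h S) (restrict h S q) = q"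
      using hB \<open>q \<in> S\<close> by (intro inv_into_f_f) (auto simp: Bij_def bij_betw_def)
    ultimately show ?thesis using assms(3) by simp
  qed
  then show "(inv\<^bsub>BijGroup S\<^esub> (restrict h S)) p = restrict k S p"
    by (simp add: inv_BijGroup[OF hB])
qed

lemma inv_generators:
  "inv\<^bsub>BijGroup (surface A B C D)\<^esub> (restrict (s_z C \<circ> s_y B) (surface A B C D)) = restrict (s_y B \<circ> s_z C) (surface A B C D)"
  "inv\<^bsub>BijGroup (surface A B C D)\<^esub> (restrict (s_x A \<circ> s_z C) (surface A B C D)) = restrict (s_z C \<circ> s_x A) (surface A B C D)"
  "inv\<^bsub>BijGroup (surface A B C D)\<^esub> (restrict (s_y B \<circ> s_x A) (surface A B C D)) = restrict (s_x A \<circ> s_y B) (surface A B C D)"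
  by (rule inv_restrict_BijGroup;
      simp add: bij_betw_moves moves_def s_x_s_x s_y_s_y s_z_s_z s_x_surface s_y_surface s_z_surface)+

lemma aut_group_subset_Bij: "aut_group A B C D \<subseteq> Bij (surface A B C D)"
  using subgroup.subset[OF subgroup_aut_group] by (auto simp: BijGroup_def)

lemma aut_group_bij: "g \<in> aut_group A B C D \<Longrightarrow> bij_betw g (surface A B C D) (surface A B C D)"
  using aut_group_subset_Bij[of A B C D] by (auto simp: Bij_def)

lemma aut_group_surface: "g \<in> aut_group A B C D \<Longrightarrow> p \<in> surface A B C D \<Longrightarrow> g p \<in> surface A B C D"
  using aut_group_bij bij_betwE by blast

lemma BijGroup_mult: "g \<in> Bij S \<Longrightarrow> f \<in> Bij S \<Longrightarrow> g \<otimes>\<^bsub>BijGroup S\<^esub> f = compose S g f"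
  by (simp add: BijGroup_def)

lemma aut_group_id: "restrict (\<lambda>p. p) (surface A B C D) \<in> aut_group A B C D"
  using subgroup.one_closed[OF subgroup_aut_group[of A B C D]] by (simp only: BijGroup_def monoid.simps)

lemma aut_group_compose:
  assumes "g \<in> aut_group A B C D" "f \<in> aut_group A B C D"
  shows "compose (surface A B C D) g f \<in> aut_group A B C D"
proof -
  have "g \<otimes>\<^bsub>BijGroup (surface A B C D)\<^esub> f = compose (surface A B C D) g f"
    using assms aut_group_subset_Bij by (intro BijGroup_mult) blast+
  then show ?thesis
    using subgroup.m_closed[OF subgroup_aut_group assms] by simp
qed

lemma aut_group_inverse:
  assumes "g \<in> aut_group A B C D"
  obtains g' where "g' \<in> aut_group A B C D"
    "\<And>p. p \<in> surface A B C D \<Longrightarrow> g' (g p) = p" "\<And>p. p \<in> surface A B C D \<Longrightarrow> g (g' p) = p"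
proof
  have gB: "g \<in> Bij (surface A B C D)" and b: "bij_betw g (surface A B C D) (surface A B C D)"
    using assms aut_group_subset_Bij aut_group_bij by blast+
  let ?g = "inv\<^bsub>BijGroup (surface A B C D)\<^esub> g"
  show "?g \<in> aut_group A B C D"
    by (rule subgroup.m_inv_closed[OF subgroup_aut_group assms])
  show "?g (g p) = p" "g (?g p) = p" if "p \<in> surface A B C D" for p
    using b that aut_group_surface[OF assms that]
    by (simp_all add: inv_BijGroup[OF gB] bij_betw_inv_into_left bij_betw_inv_into_right)
qed

lemma aut_group_moves:
  assumes "h \<in> moves A B C"
  shows "restrict h (surface A B C D) \<in> aut_group A B C D"
proof -
  have incl: "r \<in> aut_group A B C D" and inv: "inv\<^bsub>BijGroup (surface A B C D)\<^esub> r \<in> aut_group A B C D"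
    if "r \<in> generators A B C D" for r
    using that unfolding aut_group_def by (auto intro: generate.incl generate.inv)
  show ?thesis
    using assms restrict_generators[where A=A and B=B and C=C and D=D, THEN incl]
      restrict_generators[where A=A and B=B and C=C and D=D, THEN inv]
    unfolding moves_def inv_generators insert_iff by (elim disjE emptyE) simp_all
qed

lemma aut_group_moves_pow:
  assumes "h \<in> moves A B C"
  shows "restrict (h ^^ n) (surface A B C D) \<in> aut_group A B C D"
proof (induction n)
  case 0
  show ?case using aut_group_id by (simp only: funpow.simps id_def)
next
  case (Suc n)
  have "(h ^^ n) p \<in> surface A B C D" if "p \<in> surface A B C D" for p
    using that by (induction n) (auto intro: moves_surface[OF assms])
  then have eq: "restrict (h ^^ Suc n) (surface A B C D) =
      compose (surface A B C D) (restrict h (surface A B C D)) (restrict (h ^^ n) (surface A B C D))"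
    by (auto simp: fun_eq_iff compose_def)
  show ?case unfolding eq by (rule aut_group_compose[OF aut_group_moves[OF assms] Suc])
qed

text \<open>Inverse generators are again products of two involutions and count as letters, so an
  induction over the group has no case for inverses.\<close>

lemma aut_group_induct [consumes 1, case_names id move compose]:
  assumes "g \<in> aut_group A B C D"
    and id: "P (restrict (\<lambda>p. p) (surface A B C D))"
    and move: "\<And>h. h \<in> moves A B C \<Longrightarrow> P (restrict h (surface A B C D))"
    and comp: "\<And>g f. g \<in> aut_group A B C D \<Longrightarrow> f \<in> aut_group A B C D \<Longrightarrow> P g \<Longrightarrow> P f \<Longrightarrow>
      P (compose (surface A B C D) g f)"
  shows "P g"
  using assms(1) unfolding aut_group_def
proof (induction rule: generate.induct)
  case one
  then show ?case using id by (simp only: BijGroup_def monoid.simps)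
next
  case (incl h)
  then show ?case
    by (auto simp: generators_def g_x_def g_y_def g_z_def moves_def intro!: move)
next
  case (inv h)
  then show ?case
    unfolding generators_def g_x_def g_y_def g_z_def
    by (elim imageE insertE emptyE) (simp_all only: inv_generators, auto simp only: moves_def intro!: move)
next
  case (eng h1 h2)
  then have *: "h1 \<in> aut_group A B C D" "h2 \<in> aut_group A B C D"
    by (simp_all add: aut_group_def)
  then have "h1 \<otimes>\<^bsub>BijGroup (surface A B C D)\<^esub> h2 = compose (surface A B C D) h1 h2"
    using aut_group_subset_Bij by (intro BijGroup_mult) blast+
  then show ?case using comp[OF * eng.IH] by simp
qed

lemma continuous_on_restrict_iff: "continuous_on S (restrict h S) \<longleftrightarrow> continuous_on S h"
  by (rule continuous_on_cong) auto

lemma continuous_on_compose_set: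
  assumes "continuous_on S g" "continuous_on S f" "f ` S \<subseteq> S"
  shows "continuous_on S (compose S g f)"
  unfolding compose_def continuous_on_restrict_iff by (rule continuous_on_compose2[OF assms])

lemma continuous_on_moves:
  assumes "h \<in> moves A B C"
  shows "continuous_on UNIV h"
proof -
  have s: "continuous_on UNIV (s_x A)" "continuous_on UNIV (s_y B)" "continuous_on UNIV (s_z C)"
    unfolding s_x_def s_y_def s_z_def case_prod_unfold by (intro continuous_intros)+
  have comp: "continuous_on UNIV (k \<circ> k')" if "continuous_on UNIV k" "continuous_on UNIV k'"
    for k k' :: "complex \<times> complex \<times> complex \<Rightarrow> complex \<times> complex \<times> complex"
    by (rule continuous_on_compose[OF that(2) continuous_on_subset[OF that(1) subset_UNIV]])
  have "\<forall>h\<in>moves A B C. continuous_on UNIV h"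
    unfolding moves_def ball_simps by (intro conjI TrueI comp s)
  then show ?thesis using assms by blast
qed

lemma continuous_on_aut_group:
  assumes "g \<in> aut_group A B C D"
  shows "continuous_on (surface A B C D) g"
  using assms
proof (induction rule: aut_group_induct)
  case id
  show ?case by (rule continuous_on_restrict_iff[THEN iffD2, OF continuous_on_id])
next
  case (move h)
  show ?case
    by (rule continuous_on_restrict_iff[THEN iffD2, OF continuous_on_subset[OF continuous_on_moves[OF move] subset_UNIV]])
next
  case (compose g f)
  show ?case
    using compose(3,4) image_subsetI[OF aut_group_surface[OF compose(2)]] by (rule continuous_on_compose_set)
qed

lemma closed_surface: "closed (surface A B C D)"
  unfolding surface_def case_prod_unfold by (intro closed_Collect_eq continuous_intros)

subsection \<open>Holomorphic discs in the surface\<close>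

text \<open>Schottky's theorem bounds \<open>f\<close> on the half disc independently of
  \<open>f\<close>; the Schwarz lemma, applied to \<open>f - f 0\<close> rescaled from that disc,
  turns the bound into a Lipschitz estimate at the centre. This yields equicontinuity.\<close>

lemma Schottky_Lipschitz:
  obtains M :: real where "M > 0"
    "\<And>f u. \<lbrakk>f holomorphic_on cball 0 1; \<And>z. z \<in> cball 0 1 \<Longrightarrow> f z \<noteq> 0 \<and> f z \<noteq> 1; norm (f 0) \<le> R; norm u < 1/2\<rbrakk>
      \<Longrightarrow> norm (f u) \<le> M \<and> norm (f u - f 0) \<le> M * norm u"
proof
  define N where "N = exp (pi * exp (pi * (2 + 2 * R + 12 * (1/2) / (1 - 1/2))))"
  have N: "N > 0" by (simp add: N_def)
  then show "6 * N > 0" by simp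
  fix f :: "complex \<Rightarrow> complex" and u :: complex
  assume hol: "f holomorphic_on cball 0 1" and nz: "\<And>z. z \<in> cball 0 1 \<Longrightarrow> f z \<noteq> 0 \<and> f z \<noteq> 1"
    and R: "norm (f 0) \<le> R" and u: "norm u < 1/2"
  have bd: "norm (f z) \<le> N" if "norm z \<le> 1/2" for z
    unfolding N_def using Schottky[OF hol R _ _ _ that] nz by simp
  \<comment> \<open>The difference is at most \<open>2 * N\<close>; dividing by \<open>3 * N\<close>
    gives the strict bound 1 of the Schwarz lemma.\<close>
  define g where "g = (\<lambda>v. (f (v / 2) - f 0) / (3 * N))"
  have "norm (g (2 * u)) \<le> norm (2 * u)"
  proof (rule Schwarz_Lemma(1))
    have "(f \<circ> (\<lambda>v. v / 2)) holomorphic_on ball 0 1"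
      by (rule holomorphic_on_compose_gen[OF _ hol]) (auto simp: norm_divide intro!: holomorphic_intros)
    then have "(\<lambda>v. f (v / 2)) holomorphic_on ball 0 1" by (simp add: comp_def)
    then show "g holomorphic_on ball 0 1"
      unfolding g_def using N by (intro holomorphic_on_divide holomorphic_on_diff) auto
    show "g 0 = 0" by (simp add: g_def)
    show "norm (g z) < 1" if "norm z < 1" for z
    proof -
      have "norm (f (z / 2) - f 0) \<le> N + N"
        using bd[of "z/2"] bd[of 0] that norm_triangle_ineq4[of "f (z/2)" "f 0"] by (simp add: norm_divide)
      then show ?thesis using N by (simp add: g_def norm_divide norm_mult)
    qed
    show "norm (2 * u) < 1" using u by (simp add: norm_mult)
  qed
  then have "norm (f u - f 0) \<le> 6 * N * norm u"
    using N by (simp add: g_def norm_divide norm_mult field_simps)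
  moreover have "norm (f u) \<le> 6 * N"
    using bd[of u] u N by simp
  ultimately show "norm (f u) \<le> 6 * N \<and> norm (f u - f 0) \<le> 6 * N * norm u" by simp
qed

text \<open>The value at \<open>y0\<close> is the product of the differences to the two roots, so
  one of them has norm below \<open>e\<close>. No branch of the root has to be chosen.\<close>

lemma quadratic_root_near:
  fixes b c y0 :: complex
  assumes "norm (y0^2 + b * y0 + c) < e^2" "e > 0"
  obtains y where "y^2 + b * y + c = 0" "dist y y0 < e"
proof -
  define s where "s = csqrt (b^2 - 4 * c)"
  have s2: "s^2 = b^2 - 4 * c" by (simp add: s_def)
  define r where "r = (- b + s) / 2"
  define r' where "r' = (- b - s) / 2"
  have fac: "y^2 + b * y + c = (y - r) * (y - r')" for y
  proof -
    have "(y - r) * (y - r') = y^2 + b * y + (b^2 - s^2) / 4"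
      unfolding r_def r'_def by (simp add: field_simps power2_eq_square)
    then show ?thesis by (simp add: s2)
  qed
  have "norm (y0 - r) < e \<or> norm (y0 - r') < e"
  proof (rule ccontr)
    assume "\<not> ?thesis"
    then have "e * e \<le> norm (y0 - r) * norm (y0 - r')"
      using assms(2) by (intro mult_mono) auto
    then show False
      using assms(1) unfolding fac by (simp add: norm_mult power2_eq_square)
  qed
  then show thesis
    using that[of r] that[of r'] fac by (auto simp: dist_norm norm_minus_commute)
qed

text \<open>Over \<open>(x, z)\<close> the surface is a monic quadratic in \<open>y\<close>. Its
  value \<open>P\<close> at \<open>y0\<close> is continuous in \<open>(x, z)\<close> and vanishes at
  the base point, so a root stays near \<open>y0\<close>, also at singular points.\<close>

lemma surface_lift:
  assumes "(x0, y0, z0) \<in> surface A B C D" "e > 0"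
  obtains d where "d > 0"
    "\<And>x z. dist x x0 < d \<Longrightarrow> dist z z0 < d \<Longrightarrow> \<exists>y. dist y y0 < e \<and> (x, y, z) \<in> surface A B C D"
proof -
  define P where "P = (\<lambda>w. y0^2 + (fst w * snd w - B) * y0 + ((fst w)^2 + (snd w)^2 - A * fst w - C * snd w - D))"
  have "isCont P (x0, z0)"
    unfolding P_def by (intro continuous_intros)
  moreover have "P (x0, z0) = 0"
    using assms(1) by (simp add: P_def surface_def algebra_simps)
  ultimately obtain d where d: "d > 0" "\<And>w. dist w (x0, z0) < d \<Longrightarrow> norm (P w) < e^2"
    using assms(2) unfolding continuous_at_eps_delta by (metis dist_0_norm dist_commute zero_less_power)
  show thesis
  proof (rule that)
    show "d / 2 > 0" using d by simp
    fix x z assume "dist x x0 < d / 2" "dist z z0 < d / 2"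
    then have "dist (x, z) (x0, z0) < d"
      using sqrt_sum_squares_le_sum[of "dist x x0" "dist z z0"] by (simp add: dist_Pair_Pair)
    from d(2)[OF this] obtain y where
      "y^2 + (x * z - B) * y + (x^2 + z^2 - A * x - C * z - D) = 0" "dist y y0 < e"
      using quadratic_root_near[of y0 "x * z - B" _ e] assms(2) unfolding P_def by auto
    then show "\<exists>y. dist y y0 < e \<and> (x, y, z) \<in> surface A B C D"
      by (intro exI[of _ y]) (simp add: surface_def algebra_simps)
  qed
qed

section \<open>Joining nearby points by holomorphic discs\<close>

definition holomorphic3_on :: "(complex \<Rightarrow> complex \<times> complex \<times> complex) \<Rightarrow> complex set \<Rightarrow> bool" where
  "holomorphic3_on \<psi> X \<longleftrightarrow> (\<lambda>u. fst (\<psi> u)) holomorphic_on X \<and> (\<lambda>u. fst (snd (\<psi> u))) holomorphic_on X \<and>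
     (\<lambda>u. snd (snd (\<psi> u))) holomorphic_on X"

definition disc_joins :: "(complex \<times> complex \<times> complex) set \<Rightarrow>
    complex \<times> complex \<times> complex \<Rightarrow> complex \<times> complex \<times> complex \<Rightarrow> complex \<Rightarrow> bool" where
  "disc_joins T q q' u \<longleftrightarrow>
     (\<exists>\<psi>. \<psi> ` cball 0 1 \<subseteq> T \<and> holomorphic3_on \<psi> (cball 0 1) \<and> \<psi> 0 = q \<and> \<psi> u = q')"

text \<open>The radius 1/2 is where the Schottky estimate holds, and the factor \<open>k\<close>
  turns a Lipschitz bound in the parameter into one in the distance. Either point may be the centre,
  so that bounds transfer in both directions.\<close>

definition discs_near :: "(complex \<times> complex \<times> complex) set \<Rightarrow> (complex \<times> complex \<times> complex) set \<Rightarrow>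
    complex \<times> complex \<times> complex \<Rightarrow> bool" where
  "discs_near S T p \<longleftrightarrow> (\<exists>\<epsilon>>0. \<exists>k>0. \<forall>q\<in>S \<inter> cball p \<epsilon>. \<forall>q'\<in>S \<inter> cball p \<epsilon>.
     \<exists>u. disc_joins T q q' u \<and> norm u < 1/2 \<and> norm u \<le> k * dist q q')"

lemma disc_joins_rot:
  assumes "disc_joins T q q' u"
  shows "disc_joins (rot ` T) (rot q) (rot q') u"
proof -
  obtain \<psi> where "\<psi> ` cball 0 1 \<subseteq> T" "holomorphic3_on \<psi> (cball 0 1)" "\<psi> 0 = q" "\<psi> u = q'"
    using assms by (auto simp: disc_joins_def)
  then show ?thesis
    unfolding disc_joins_def by (intro exI[of _ "rot \<circ> \<psi>"]) (auto simp: holomorphic3_on_def)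
qed

lemma discs_near_rot:
  assumes "discs_near S T p"
  shows "discs_near (rot ` S) (rot ` T) (rot p)"
proof -
  obtain \<epsilon> k where *: "\<epsilon> > 0" "k > 0" "\<And>q q'. q \<in> S \<inter> cball p \<epsilon> \<Longrightarrow> q' \<in> S \<inter> cball p \<epsilon> \<Longrightarrow>
     \<exists>u. disc_joins T q q' u \<and> norm u < 1/2 \<and> norm u \<le> k * dist q q'"
    using assms unfolding discs_near_def by blast
  have "\<exists>u. disc_joins (rot ` T) (rot q) (rot q') u \<and> norm u < 1/2 \<and> norm u \<le> k * dist (rot q) (rot q')"
    if "q \<in> S" "q' \<in> S" "dist p q \<le> \<epsilon>" "dist p q' \<le> \<epsilon>" for q q'
    using *(3)[of q q'] that disc_joins_rot by fastforce
  then show ?thesis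
    unfolding discs_near_def using *(1,2) by (intro exI[of _ \<epsilon>] exI[of _ k] conjI) auto
qed

lemma rot_image_surface: "rot ` surface A B C D = surface B C A D"
proof
  show "rot ` surface A B C D \<subseteq> surface B C A D"
    by (auto simp: rot_surface)
  show "surface B C A D \<subseteq> rot ` surface A B C D"
  proof
    fix p assume "p \<in> surface B C A D"
    then have "rot (rot p) \<in> surface A B C D"
      by (simp add: rot_surface)
    then show "p \<in> rot ` surface A B C D"
      using imageI[of "rot (rot p)" "surface A B C D" rot] by simp
  qed
qed

lemma open_rot_image:
  assumes "open W"
  shows "open (rot ` W)"
proof -
  have "rot ` W = (\<lambda>p. rot (rot p)) -` W"
    by (force intro: image_eqI[of _ _ "rot (rot _)"])
  moreover have "continuous_on UNIV (\<lambda>p. rot (rot p))"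
    by (intro continuous_on_compose2[OF continuous_on_rot continuous_on_rot]) auto
  ultimately show ?thesis
    using assms by (simp add: open_vimage)
qed

text \<open>Where the partial derivative in \<open>y\<close> does not vanish, \<open>y\<close> is an explicit holomorphic function
  of \<open>(x, z)\<close>, the square root being normalised at the base point by the factor \<open>\<sigma>\<close>. The discs
  are images of complex lines in the \<open>(x, z)\<close>-plane.\<close>

lemma discs_near_smooth_y:
  assumes p: "(x0, y0, z0) \<in> surface A B C D" and sm: "2 * y0 + x0 * z0 \<noteq> B"
    and W: "open W" "(x0, y0, z0) \<in> W"
  shows "discs_near (surface A B C D) (surface A B C D \<inter> W) (x0, y0, z0)"
proof -
  \<comment> \<open>The partial derivative in \<open>y\<close> of the defining polynomial at the
    base point; \<open>\<Delta>\<close> is the discriminant of the quadratic in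
    \<open>y\<close>.\<close>
  define \<sigma> where "\<sigma> = 2 * y0 + x0 * z0 - B"
  have \<sigma>: "\<sigma> \<noteq> 0" using sm by (simp add: \<sigma>_def)
  define \<Delta> where "\<Delta> = (\<lambda>x z. (B - x * z)^2 - 4 * (x^2 + z^2 - A * x - C * z - D))"
  have \<Delta>: "(2 * y + x * z - B)^2 = \<Delta> x z" if "(x, y, z) \<in> surface A B C D" for x y z
  proof -
    have "(2 * y + x * z - B)^2 = (B - x * z)^2 + 4 * (y^2 + x * y * z - B * y)"
      by (simp add: algebra_simps power2_eq_square)
    also have "y^2 + x * y * z - B * y = - (x^2 + z^2 - A * x - C * z - D)"
      using that by (simp add: surface_def algebra_simps)
    finally show ?thesis by (simp add: \<Delta>_def)
  qed
  define Y where "Y = (\<lambda>x z. (B - x * z + \<sigma> * csqrt (\<Delta> x z / \<sigma>^2)) / 2)"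
  have surf: "(x, Y x z, z) \<in> surface A B C D" for x z
  proof -
    have "2 * Y x z + x * z - B = \<sigma> * csqrt (\<Delta> x z / \<sigma>^2)"
      by (simp add: Y_def field_simps)
    then have "(2 * Y x z + x * z - B)^2 = \<Delta> x z"
      using \<sigma> by (simp add: power_mult_distrib)
    then have "4 * ((Y x z)^2 + x * Y x z * z - B * Y x z + (x^2 + z^2 - A * x - C * z - D)) = 0"
      by (simp add: \<Delta>_def algebra_simps power2_eq_square)
    then have "(Y x z)^2 + x * Y x z * z - B * Y x z + (x^2 + z^2 - A * x - C * z - D) = 0"
      unfolding mult_eq_0_iff by (elim disjE) simp_all
    then show ?thesis by (simp add: surface_def algebra_simps)
  qed
  \<comment> \<open>The principal square root selects the root whose \<open>y\<close>-derivative,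
    divided by \<open>\<sigma>\<close>, lies in the right half-plane.\<close>
  have YI: "Y x z = y" if "(x, y, z) \<in> surface A B C D" "Re ((2 * y + x * z - B) / \<sigma>) > 0" for x y z
  proof -
    have "csqrt (\<Delta> x z / \<sigma>^2) = (2 * y + x * z - B) / \<sigma>"
      using csqrt_square[of "(2 * y + x * z - B) / \<sigma>"] that \<Delta>[OF that(1)] by (simp add: power_divide)
    then show ?thesis using \<sigma> by (simp add: Y_def)
  qed
  have Y0: "Y x0 z0 = y0"
    using YI[OF p] \<sigma> by (simp add: \<sigma>_def)
  have \<Delta>0: "\<Delta> x0 z0 / \<sigma>^2 = 1"
  proof -
    have "\<Delta> x0 z0 = \<sigma>^2" using \<Delta>[OF p] by (simp add: \<sigma>_def)
    then show ?thesis using \<sigma> by simp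
  qed
  define H where "H = (\<lambda>w. \<Delta> (fst w) (snd w) / \<sigma>^2)"
  have contH: "isCont H w" for w
    unfolding H_def \<Delta>_def using \<sigma> by (intro continuous_intros) auto
  have "isCont (\<lambda>w. (fst w, Y (fst w) (snd w), snd w)) (x0, z0)"
  proof -
    have "isCont (\<lambda>w. csqrt (H w)) (x0, z0)"
      using \<Delta>0 by (intro isCont_csqrt' contH) (auto simp: H_def)
    then show ?thesis
      unfolding Y_def H_def by (intro continuous_intros) auto
  qed
  moreover have "(fst (x0, z0), Y (fst (x0, z0)) (snd (x0, z0)), snd (x0, z0)) \<in> W"
    using W Y0 by simp
  ultimately have "\<forall>\<^sub>F w in at (x0, z0). (fst w, Y (fst w) (snd w), snd w) \<in> W"
    using W(1) by (intro topological_tendstoD[of _ "(x0, Y x0 z0, z0)"]) (auto simp: isCont_def)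
  then obtain R1 where R1: "R1 > 0" "\<And>w. w \<noteq> (x0, z0) \<Longrightarrow> dist w (x0, z0) < R1 \<Longrightarrow> (fst w, Y (fst w) (snd w), snd w) \<in> W"
    unfolding eventually_at by auto
  obtain R2 where R2: "R2 > 0" "\<And>w. dist w (x0, z0) < R2 \<Longrightarrow> dist (H w) 1 < 1"
    using contH[of "(x0, z0)"] \<Delta>0 unfolding continuous_at_eps_delta H_def
    by (metis fst_conv snd_conv zero_less_one)
  define R where "R = min R1 R2"
  have R: "R > 0" using R1 R2 by (simp add: R_def)
  \<comment> \<open>The neighbourhood obtained from the limit is punctured, hence the separate case
    of the base point.\<close>
  have inW: "(x, Y x z, z) \<in> W" if "dist (x, z) (x0, z0) < R" for x z
    using R1(2)[of "(x, z)"] that W Y0 by (cases "(x, z) = (x0, z0)") (auto simp: R_def)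
  have slit: "\<Delta> x z / \<sigma>^2 \<notin> \<real>\<^sub>\<le>\<^sub>0" if "dist (x, z) (x0, z0) < R" for x z
  proof -
    have "dist (\<Delta> x z / \<sigma>^2) 1 < 1"
      using R2(2)[of "(x, z)"] that by (simp add: R_def H_def)
    then have "\<bar>Re (\<Delta> x z / \<sigma>^2 - 1)\<bar> < 1"
      using abs_Re_le_cmod le_less_trans unfolding dist_norm by blast
    then have "Re (\<Delta> x z / \<sigma>^2) > 0" by simp
    then show ?thesis by (auto simp: complex_nonpos_Reals_iff)
  qed
  \<comment> \<open>The \<open>y\<close>-derivative relative to its value at the base point. As it
    stays within 1 of 1, all nearby points of the surface are on the graph of
    \<open>Y\<close>.\<close>
  define E where "E = (\<lambda>q. (2 * fst (snd q) + fst q * snd (snd q) - B) / \<sigma>)"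
  have "isCont E (x0, y0, z0)"
    unfolding E_def using \<sigma> by (intro continuous_intros) auto
  moreover have E0: "E (x0, y0, z0) = 1" using \<sigma> by (simp add: E_def \<sigma>_def)
  ultimately obtain e1 where e1: "e1 > 0" "\<And>q. dist q (x0, y0, z0) < e1 \<Longrightarrow> dist (E q) 1 < 1"
    unfolding continuous_at_eps_delta by (metis zero_less_one)
  have Epos: "Re (E q) > 0" if "dist q (x0, y0, z0) < e1" for q
  proof -
    have "\<bar>Re (E q - 1)\<bar> < 1"
      using abs_Re_le_cmod e1(2)[OF that] le_less_trans unfolding dist_norm by blast
    then show ?thesis by simp
  qed
  \<comment> \<open>Two points of the ball have distance at most \<open>R / 8\<close>, so the
    parameter \<open>2 / R * dist q q'\<close> is at most 1/4; and \<open>R / 16 + R / 2 < R\<close>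
    keeps the discs where \<open>Y\<close> is holomorphic.\<close>
  define \<epsilon> where "\<epsilon> = min (e1 / 2) (R / 16)"
  have \<epsilon>: "\<epsilon> > 0" "\<epsilon> < e1" "16 * \<epsilon> \<le> R" using e1 R by (auto simp: \<epsilon>_def)
  have join: "\<exists>u. disc_joins (surface A B C D \<inter> W) q q' u \<and> norm u < 1/2 \<and> norm u \<le> 2 / R * dist q q'"
    if q: "q \<in> surface A B C D \<inter> cball (x0, y0, z0) \<epsilon>" "q' \<in> surface A B C D \<inter> cball (x0, y0, z0) \<epsilon>" for q q'
  proof (cases "q = q'")
    \<comment> \<open>The scaling in the other case divides by the distance, so equal points get a
      constant disc.\<close>
    case True
    then have "q \<in> surface A B C D" "dist q (x0, y0, z0) < e1" using q \<epsilon> by (auto simp: dist_commute)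
    obtain x1 y1 z1 where q': "q = (x1, y1, z1)" by (cases q)
    have "dist (x1, z1) (x0, z0) \<le> dist q (x0, y0, z0)"
      unfolding q' dist_Pair_Pair by (auto simp: dist_Pair_Pair)
    also have "\<dots> < R" using q \<epsilon> by (auto simp: dist_commute)
    finally have "q \<in> W"
      using inW[of x1 z1] YI[of x1 y1 z1] Epos[of q] \<open>q \<in> surface A B C D\<close> \<open>dist q (x0, y0, z0) < e1\<close>
      by (simp add: q' E_def)
    then have "disc_joins (surface A B C D \<inter> W) q q' 0"
      using True q unfolding disc_joins_def by (intro exI[of _ "\<lambda>_. q"]) (auto simp: holomorphic3_on_def)
    then show ?thesis using R by (intro exI[of _ 0]) auto
  next
    case False
    obtain x1 y1 z1 where q1: "q = (x1, y1, z1)" by (cases q)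
    obtain x2 y2 z2 where q2: "q' = (x2, y2, z2)" by (cases q')
    define d where "d = dist q q'"
    have d: "d > 0" using False by (simp add: d_def)
    have "d \<le> 2 * \<epsilon>"
      using dist_triangle3[of q q' "(x0, y0, z0)"] q by (auto simp: d_def)
    \<comment> \<open>The complex line through the two projections is scaled so that the unit disc
      stays within \<open>R / 2\<close> of the first; the second is then reached at the parameter
      \<open>1 / c = 2 * d / R\<close>.\<close>
    define c where "c = R / (2 * d)"
    have c: "c > 0" using d R by (simp add: c_def)
    define X where "X = (\<lambda>u. x1 + u * of_real c * (x2 - x1))"
    define Z where "Z = (\<lambda>u. z1 + u * of_real c * (z2 - z1))"
    have close: "dist (X u, Z u) (x0, z0) < R" if "norm u \<le> 1" for u
    proof -
      have "(X u, Z u) - (x1, z1) = (u * of_real c * (x2 - x1), u * of_real c * (z2 - z1))"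
        by (simp add: X_def Z_def)
      then have "dist (X u, Z u) (x1, z1) = norm u * c * norm (x2 - x1, z2 - z1)"
        using c by (simp add: dist_norm norm_Pair norm_mult power_mult_distrib flip: distrib_left)
          (simp add: real_sqrt_mult)
      also have "norm (x2 - x1, z2 - z1) \<le> d"
        unfolding d_def q1 q2 by (auto simp: dist_norm norm_Pair norm_minus_commute)
      then have "norm u * c * norm (x2 - x1, z2 - z1) \<le> 1 * c * d"
        using that c by (intro mult_mono) auto
      also have "1 * c * d = R / 2" using d by (simp add: c_def)
      finally have "dist (X u, Z u) (x1, z1) \<le> R / 2" .
      moreover have "dist (x1, z1) (x0, z0) \<le> dist q (x0, y0, z0)"
        unfolding q1 dist_Pair_Pair by (auto simp: dist_Pair_Pair)
      moreover have "dist q (x0, y0, z0) \<le> R / 16"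
        using q \<epsilon> by (auto simp: dist_commute)
      ultimately show ?thesis
        using dist_triangle[of "(X u, Z u)" "(x0, z0)" "(x1, z1)"] R by linarith
    qed
    define \<psi> where "\<psi> = (\<lambda>u. (X u, Y (X u) (Z u), Z u))"
    define u where "u = complex_of_real (1 / c)"
    have Yq: "Y x1 z1 = y1" "Y x2 z2 = y2"
      using YI[of x1 y1 z1] YI[of x2 y2 z2] Epos[of q] Epos[of q'] q \<epsilon>
      by (auto simp: q1 q2 E_def dist_commute)
    have "disc_joins (surface A B C D \<inter> W) q q' u"
      unfolding disc_joins_def
    proof (intro exI conjI)
      show "\<psi> ` cball 0 1 \<subseteq> surface A B C D \<inter> W"
        using surf inW close by (auto simp: \<psi>_def)
      have hX: "X holomorphic_on cball 0 1" and hZ: "Z holomorphic_on cball 0 1"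
        unfolding X_def Z_def by (intro holomorphic_intros)+
      have "(\<lambda>u. csqrt (\<Delta> (X u) (Z u) / \<sigma>^2)) holomorphic_on cball 0 1"
      proof (rule holomorphic_on_csqrt')
        show "(\<lambda>u. \<Delta> (X u) (Z u) / \<sigma>^2) holomorphic_on cball 0 1"
          unfolding \<Delta>_def using \<sigma> by (intro holomorphic_intros hX hZ) auto
      qed (use slit close in auto)
      then have "(\<lambda>u. Y (X u) (Z u)) holomorphic_on cball 0 1"
        unfolding Y_def
        by (intro holomorphic_on_divide holomorphic_on_add holomorphic_on_diff holomorphic_on_mult
            holomorphic_on_const hX hZ) auto
      then show "holomorphic3_on \<psi> (cball 0 1)"
        using hX hZ by (simp add: holomorphic3_on_def \<psi>_def)
      show "\<psi> 0 = q" using Yq by (simp add: \<psi>_def X_def Z_def q1)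
      have "X u = x2" "Z u = z2" using c by (simp_all add: X_def Z_def u_def)
      then show "\<psi> u = q'" using Yq by (simp add: \<psi>_def q2)
    qed
    moreover have "norm u = 2 / R * d"
      using d R by (simp add: u_def c_def norm_divide)
    moreover have "2 / R * d < 1/2"
      using \<open>d \<le> 2 * \<epsilon>\<close> \<epsilon> R d by (simp add: field_simps)
    ultimately show ?thesis by (intro exI[of _ u]) (simp add: d_def)
  qed
  show ?thesis
    unfolding discs_near_def
    by (rule exI[of _ \<epsilon>], rule conjI[OF \<epsilon>(1)], rule exI[of _ "2 / R"], intro conjI ballI join) (use R in auto)
qed

text \<open>Rotation turns a variable with nonvanishing partial derivative into \<open>y\<close>. As
  \<open>rot\<close> has order three, one rotation is undone by two more.\<close>

lemma discs_near_smooth: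
  assumes p: "(x, y, z) \<in> surface A B C D" and sm: "2 * x + y * z \<noteq> A \<or> 2 * y + x * z \<noteq> B \<or> 2 * z + x * y \<noteq> C"
    and W: "open W" "(x, y, z) \<in> W"
  shows "discs_near (surface A B C D) (surface A B C D \<inter> W) (x, y, z)"
proof -
  have inj: "inj rot" by (metis injI rot_rot_rot)
  consider "2 * y + x * z \<noteq> B" | "2 * z + x * y \<noteq> C" | "2 * x + y * z \<noteq> A" using sm by blast
  then show ?thesis
  proof cases
    case 1
    then show ?thesis using discs_near_smooth_y p W by blast
  next
    case 2
    have "discs_near (surface B C A D) (surface B C A D \<inter> rot ` W) (y, z, x)"
      using 2 p W rot_surface[of "(x, y, z)" B C A D] open_rot_image[OF W(1)] imageI[OF W(2), of rot]
      by (intro discs_near_smooth_y) (auto simp: rot_def mult.commute)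
    from discs_near_rot[OF discs_near_rot[OF this]] show ?thesis
      by (simp add: image_Int[OF inj] rot_image_surface image_image) (simp add: rot_def)
  next
    case 3
    have "discs_near (surface C A B D) (surface C A B D \<inter> rot ` rot ` W) (z, x, y)"
      using 3 p W rot_surface[of "(x, y, z)" B C A D] rot_surface[of "(y, z, x)" C A B D]
        open_rot_image[OF open_rot_image[OF W(1)]] imageI[OF imageI[OF W(2), of rot], of rot]
      by (intro discs_near_smooth_y) (auto simp: rot_def mult.commute)
    from discs_near_rot[OF this] show ?thesis
      by (simp add: image_Int[OF inj] rot_image_surface image_image) (simp add: rot_def)
  qed
qed

section \<open>Normality from omitted values\<close>

lemma holomorphic3_on_cong:
  "(\<And>u. u \<in> X \<Longrightarrow> \<psi> u = \<phi> u) \<Longrightarrow> holomorphic3_on \<psi> X \<longleftrightarrow> holomorphic3_on \<phi> X"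
  unfolding holomorphic3_on_def by (auto cong: holomorphic_cong)

lemma holomorphic3_on_s_x: "holomorphic3_on \<psi> X \<Longrightarrow> holomorphic3_on (\<lambda>u. s_x A (\<psi> u)) X"
  and holomorphic3_on_s_y: "holomorphic3_on \<psi> X \<Longrightarrow> holomorphic3_on (\<lambda>u. s_y B (\<psi> u)) X"
  and holomorphic3_on_s_z: "holomorphic3_on \<psi> X \<Longrightarrow> holomorphic3_on (\<lambda>u. s_z C (\<psi> u)) X"
  unfolding holomorphic3_on_def s_x_def s_y_def s_z_def case_prod_unfold
  by (auto intro!: holomorphic_intros)

text \<open>The induction varies the disc: for a product, the hypothesis on the outer factor is
  applied to the image of the disc under the inner one.\<close>

lemma holomorphic3_on_aut_group:
  assumes "g \<in> aut_group A B C D" "\<psi> ` X \<subseteq> surface A B C D" "holomorphic3_on \<psi> X"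
  shows "holomorphic3_on (\<lambda>u. g (\<psi> u)) X"
  using assms
proof (induction arbitrary: \<psi> rule: aut_group_induct)
  case id
  then show ?case
    by (subst holomorphic3_on_cong[where \<phi> = \<psi>]) auto
next
  case (move h)
  have "\<forall>h\<in>moves A B C. holomorphic3_on (\<lambda>u. h (\<psi> u)) X"
    unfolding moves_def ball_simps comp_def
    by (intro conjI TrueI holomorphic3_on_s_x holomorphic3_on_s_y holomorphic3_on_s_z move(3))
  then have "holomorphic3_on (\<lambda>u. h (\<psi> u)) X"
    using move(1) by blast
  then show ?case
    by (subst holomorphic3_on_cong[where \<phi> = "\<lambda>u. h (\<psi> u)"]) (use move(2) in auto)
next
  case (compose g f)
  have "(\<lambda>u. f (\<psi> u)) ` X \<subseteq> surface A B C D"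
    by (intro image_subsetI aut_group_surface[OF compose(2)]) (use compose.prems in blast)
  then have "holomorphic3_on (\<lambda>u. g (f (\<psi> u))) X"
    by (intro compose.IH compose.prems)
  then show ?case
    by (subst holomorphic3_on_cong[where \<phi> = "\<lambda>u. g (f (\<psi> u))"])
      (use compose.prems in \<open>auto simp: compose_def\<close>)
qed

lemma norm_triple_le: "norm p \<le> norm (fst p) + norm (fst (snd p)) + norm (snd (snd p))"
  using norm_Pair_le[of "fst p" "snd p"] norm_Pair_le[of "fst (snd p)" "snd (snd p)"] by simp

definition coordinates :: "(complex \<times> complex \<times> complex \<Rightarrow> complex) set" where
  "coordinates = {fst, \<lambda>p. fst (snd p), \<lambda>p. snd (snd p)}"

lemma coordinate_le: "c \<in> coordinates \<Longrightarrow> norm (c p) \<le> norm p"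
  using norm_fst_le[of "fst p" "snd p"] norm_snd_le[of "snd p" "fst p"]
    norm_fst_le[of "fst (snd p)" "snd (snd p)"] norm_snd_le[of "snd (snd p)" "fst (snd p)"]
  by (auto simp: coordinates_def)

lemma norm_le_coordinates:
  assumes "\<And>c. c \<in> coordinates \<Longrightarrow> norm (c p) \<le> M"
  shows "norm p \<le> 3 * M"
  using norm_triple_le[of p] assms[of fst] assms[of "\<lambda>p. fst (snd p)"] assms[of "\<lambda>p. snd (snd p)"]
  by (simp add: coordinates_def)

lemma coordinate_diff: "c \<in> coordinates \<Longrightarrow> c (p - q) = c p - c q"
  by (auto simp: coordinates_def)

text \<open>The criterion replaces Montel's theorem: Schottky's theorem, applied along holomorphic discs,
  bounds the group elements near \<open>p\<close> by their value at \<open>p\<close> and conversely.\<close>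

lemma fatou_setI:
  assumes p: "p \<in> surface A B C D" and discs: "discs_near (surface A B C D) (surface A B C D \<inter> W) p"
    and avoid: "\<And>g q c. g \<in> aut_group A B C D \<Longrightarrow> q \<in> surface A B C D \<inter> W \<Longrightarrow> c \<in> coordinates \<Longrightarrow> c (g q) \<notin> {0, 1}"
  shows "p \<in> fatou_set A B C D"
proof -
  let ?S = "surface A B C D" and ?G = "aut_group A B C D"
  obtain \<epsilon> k where \<epsilon>: "\<epsilon> > 0" and k: "k > 0" and join: "\<And>q q'. q \<in> ?S \<inter> cball p \<epsilon> \<Longrightarrow> q' \<in> ?S \<inter> cball p \<epsilon> \<Longrightarrow>
     \<exists>u. disc_joins (?S \<inter> W) q q' u \<and> norm u < 1/2 \<and> norm u \<le> k * dist q q'"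
    using discs unfolding discs_near_def by blast
  define K where "K = ?S \<inter> cball p \<epsilon>"
  have K: "compact K" "p \<in> K" "K \<subseteq> ?S"
    using closed_surface p \<epsilon> by (auto simp: K_def intro: closed_Int_compact)
  \<comment> \<open>The constant does not depend on \<open>g\<close>, and \<open>q\<close>,
    \<open>q'\<close> range over all of \<open>K\<close>; hence the estimate can be read in both
    directions.\<close>
  have coord: "\<exists>M>0. \<forall>g\<in>?G. \<forall>c\<in>coordinates. \<forall>q\<in>K. \<forall>q'\<in>K. norm (c (g q)) \<le> R \<longrightarrow>
      norm (c (g q')) \<le> M \<and> norm (c (g q') - c (g q)) \<le> M * dist q q'" for R
  proof -
    obtain M where M: "M > 0" "\<And>f u. \<lbrakk>f holomorphic_on cball 0 1; \<And>z. z \<in> cball 0 1 \<Longrightarrow> f z \<noteq> 0 \<and> f z \<noteq> 1; norm (f 0) \<le> R; norm u < 1/2\<rbrakk>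
      \<Longrightarrow> norm (f u) \<le> M \<and> norm (f u - f 0) \<le> M * norm u"
      using Schottky_Lipschitz[of R] by metis
    have "norm (c (g q')) \<le> max M (M * k) \<and> norm (c (g q') - c (g q)) \<le> max M (M * k) * dist q q'"
      if g: "g \<in> ?G" and c: "c \<in> coordinates" and q: "q \<in> K" "q' \<in> K" and R: "norm (c (g q)) \<le> R" for g c q q'
    proof -
      obtain u \<psi> where u: "norm u < 1/2" "norm u \<le> k * dist q q'"
        and \<psi>: "\<psi> ` cball 0 1 \<subseteq> ?S \<inter> W" "holomorphic3_on \<psi> (cball 0 1)" "\<psi> 0 = q" "\<psi> u = q'"
        using join[of q q'] q unfolding K_def disc_joins_def by blast
      have "holomorphic3_on (\<lambda>v. g (\<psi> v)) (cball 0 1)"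
        using \<psi> by (intro holomorphic3_on_aut_group[OF g]) auto
      then have hol: "(\<lambda>v. c (g (\<psi> v))) holomorphic_on cball 0 1"
        using c by (auto simp: holomorphic3_on_def coordinates_def)
      have "c (g (\<psi> v)) \<noteq> 0 \<and> c (g (\<psi> v)) \<noteq> 1" if "v \<in> cball 0 1" for v
        using avoid[OF g _ c, of "\<psi> v"] \<psi>(1) that by blast
      from M(2)[OF hol this _ u(1)] have "norm (c (g q')) \<le> M \<and> norm (c (g q') - c (g q)) \<le> M * norm u"
        using R \<psi>(3,4) by simp
      moreover have "M * norm u \<le> (M * k) * dist q q'"
        using u(2) M(1) by (simp add: mult.assoc)
      moreover have "(M * k) * dist q q' \<le> max M (M * k) * dist q q'"
        by (intro mult_right_mono) auto
      ultimately show ?thesis by linarith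
    qed
    then show ?thesis using M(1) by (intro exI[of _ "max M (M * k)"]) auto
  qed
  have bound: "\<exists>M>0. \<forall>g\<in>?G. \<forall>q\<in>K. \<forall>q'\<in>K. norm (g q) \<le> R \<longrightarrow>
      norm (g q') \<le> M \<and> norm (g q' - g q) \<le> M * dist q q'" for R
  proof -
    obtain M where M: "M > 0" "\<And>g c q q'. \<lbrakk>g \<in> ?G; c \<in> coordinates; q \<in> K; q' \<in> K; norm (c (g q)) \<le> R\<rbrakk> \<Longrightarrow>
      norm (c (g q')) \<le> M \<and> norm (c (g q') - c (g q)) \<le> M * dist q q'"
      using coord[of R] by blast
    have "norm (g q') \<le> 3 * M \<and> norm (g q' - g q) \<le> 3 * (M * dist q q')"
      if "g \<in> ?G" "q \<in> K" "q' \<in> K" "norm (g q) \<le> R" for g q q'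
      using M(2)[OF that(1) _ that(2,3)] coordinate_le[of _ "g q"] that(4)
      by (intro conjI norm_le_coordinates) (force simp: coordinate_diff)+
    then show ?thesis using M(1) by (intro exI[of _ "3 * M"]) (auto simp: mult.assoc)
  qed
  have "normal_family_on ?S ?G (?S \<inter> ball p \<epsilon>)"
    unfolding normal_family_on_def
  proof (intro allI impI)
    fix f :: "nat \<Rightarrow> complex \<times> complex \<times> complex \<Rightarrow> complex \<times> complex \<times> complex"
    assume "range f \<subseteq> ?G"
    then have f: "f n \<in> ?G" for n by blast
    show "\<exists>r. strict_mono r \<and> (converges_uniformly_on_compacts (f \<circ> r) (?S \<inter> ball p \<epsilon>) \<or>
        converges_to_infinity_on ?S (f \<circ> r) (?S \<inter> ball p \<epsilon>))"
    \<comment> \<open>Either the values at \<open>p\<close> leave every ball, and the estimate drags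
      all of \<open>K\<close> along, or a subsequence is bounded at \<open>p\<close> and therefore
      bounded and equicontinuous on \<open>K\<close>.\<close>
    proof (cases "\<forall>R. finite {n. norm (f n p) \<le> R}")
      case True
      have "finite {i. f i ` V \<inter> L \<noteq> {}}" if "compact V" "V \<subseteq> ?S \<inter> ball p \<epsilon>" "compact L" "L \<subseteq> ?S" for V L
      proof -
        obtain R where R: "\<And>q. q \<in> L \<Longrightarrow> norm q \<le> R"
          using compact_imp_bounded[OF \<open>compact L\<close>] by (auto simp: bounded_iff)
        \<comment> \<open>The estimate read backwards: an index that sends a point of
          \<open>V\<close> into \<open>L\<close> has a bounded value at \<open>p\<close>, which
          happens only finitely often.\<close>
        obtain M where M: "\<And>g q. \<lbrakk>g \<in> ?G; q \<in> K; norm (g q) \<le> R\<rbrakk> \<Longrightarrow> norm (g p) \<le> M"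
          using bound[of R] K(2) by blast
        have "V \<subseteq> K" using that(2) by (auto simp: K_def)
        then have "{i. f i ` V \<inter> L \<noteq> {}} \<subseteq> {n. norm (f n p) \<le> M}"
          using M[OF f] R by blast
        then show ?thesis using True finite_subset by blast
      qed
      then have "converges_to_infinity_on ?S (f \<circ> id) (?S \<inter> ball p \<epsilon>)"
        by (simp add: converges_to_infinity_on_def)
      moreover have "strict_mono (id :: nat \<Rightarrow> nat)" by (simp add: strict_mono_def)
      ultimately show ?thesis by blast
    next
      case False
      then obtain R where inf: "infinite {n. norm (f n p) \<le> R}" by blast
      define r where "r = enumerate {n. norm (f n p) \<le> R}"
      have r: "strict_mono r" "norm (f (r n) p) \<le> R" for n
        using strict_mono_enumerate[OF inf] enumerate_in_set[OF inf, of n] by (simp_all add: r_def)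
      obtain M where M: "\<And>g q. \<lbrakk>g \<in> ?G; q \<in> K; norm (g p) \<le> R\<rbrakk> \<Longrightarrow> norm (g q) \<le> M"
        using bound[of R] K(2) by blast
      have frM: "norm (f (r n) q) \<le> M" if "q \<in> K" for n q
        using M[OF f that r(2)] .
      \<comment> \<open>A second use of the estimate, now with radius \<open>M\<close>: the
        Lipschitz bound at a general \<open>q\<close> needs a bound at \<open>q\<close>, not just at
        \<open>p\<close>.\<close>
      obtain N where N: "N > 0" "\<And>g q q'. \<lbrakk>g \<in> ?G; q \<in> K; q' \<in> K; norm (g q) \<le> M\<rbrakk> \<Longrightarrow> norm (g q' - g q) \<le> N * dist q q'"
        using bound[of M] by blast
      have equi: "\<exists>d>0. \<forall>n y. y \<in> K \<and> norm (q - y) < d \<longrightarrow> norm (f (r n) q - f (r n) y) < e"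
        if "q \<in> K" "e > 0" for q e
      proof (intro exI conjI allI impI)
        show "e / N > 0" using that N by simp
        fix n y assume y: "y \<in> K \<and> norm (q - y) < e / N"
        then have "norm (f (r n) y - f (r n) q) \<le> N * dist q y"
          using N(2)[OF f \<open>q \<in> K\<close> _ frM[OF \<open>q \<in> K\<close>]] by blast
        also have "\<dots> < e" using y N(1) by (simp add: dist_norm field_simps)
        finally show "norm (f (r n) q - f (r n) y) < e" by (simp add: norm_minus_commute)
      qed
      obtain h k' where k': "strict_mono (k' :: nat \<Rightarrow> nat)"
        and h: "\<And>e. 0 < e \<Longrightarrow> \<exists>N. \<forall>n x. n \<ge> N \<and> x \<in> K \<longrightarrow> norm (f (r (k' n)) x - h x) < e"
        using Arzela_Ascoli[OF K(1) frM equi] by metis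
      have "uniform_limit V (f \<circ> (r \<circ> k')) h sequentially" if "V \<subseteq> ?S \<inter> ball p \<epsilon>" for V
      proof (rule uniform_limitI)
        fix e :: real assume "e > 0"
        have "V \<subseteq> K" using that by (auto simp: K_def)
        then show "\<forall>\<^sub>F n in sequentially. \<forall>x\<in>V. dist ((f \<circ> (r \<circ> k')) n x) (h x) < e"
          using h[OF \<open>e > 0\<close>] unfolding eventually_sequentially dist_norm by (auto; blast)
      qed
      then have "converges_uniformly_on_compacts (f \<circ> (r \<circ> k')) (?S \<inter> ball p \<epsilon>)"
        unfolding converges_uniformly_on_compacts_def by blast
      moreover have "strict_mono (r \<circ> k')" using r(1) k' by (simp add: strict_mono_o)
      ultimately show ?thesis by blast
    qed
  qed
  moreover have "openin (top_of_set ?S) (?S \<inter> ball p \<epsilon>)"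
    by (simp add: openin_open_Int)
  ultimately show ?thesis
    unfolding fatou_set_def using p \<epsilon> by (intro CollectI conjI exI[of _ "?S \<inter> ball p \<epsilon>"]) auto
qed

subsection \<open>Dynamics on the invariant conics\<close>

text \<open>On the conic \<open>x = const\<close> the map \<open>s_z \<circ> s_y\<close> is affine with fixed point \<open>(y\<^sub>0, z\<^sub>0)\<close> and
  eigenvalues \<open>\<mu>\<^sup>2\<close>, \<open>\<mu>\<^sup>-\<^sup>2\<close>; these are its eigenfunctionals.\<close>

definition eig_a :: "complex \<Rightarrow> complex \<Rightarrow> complex \<Rightarrow> complex \<times> complex \<times> complex \<Rightarrow> complex" where
  "eig_a \<mu> y0 z0 p = (fst (snd p) - y0) - \<mu> * (snd (snd p) - z0)"

definition eig_b :: "complex \<Rightarrow> complex \<Rightarrow> complex \<Rightarrow> complex \<times> complex \<times> complex \<Rightarrow> complex" where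
  "eig_b \<mu> y0 z0 p = \<mu> * (fst (snd p) - y0) - (snd (snd p) - z0)"

text \<open>In displacements from the fixed point the map is linear, and the quadratic equation of
  \<open>\<mu>\<close> is the only relation needed. The second identity is multiplied out to avoid
  an inverse of \<open>\<mu>\<close>.\<close>

lemma eig_s_z_s_y:
  assumes l: "\<mu>^2 + fst p * \<mu> + 1 = 0" and B: "B = 2 * y0 + fst p * z0" and C: "C = 2 * z0 + fst p * y0"
  shows "eig_a \<mu> y0 z0 (s_z C (s_y B p)) = \<mu>^2 * eig_a \<mu> y0 z0 p"
    and "\<mu>^2 * eig_b \<mu> y0 z0 (s_z C (s_y B p)) = eig_b \<mu> y0 z0 p"
proof -
  obtain x y z where p: "p = (x, y, z)" by (cases p)
  define Y where "Y = y - y0"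
  define Z where "Z = z - z0"
  define Y' where "Y' = - Y - x * Z"
  have lx: "\<mu> * x = - 1 - \<mu>^2" using l by (simp add: p) (simp add: algebra_simps eq_neg_iff_add_eq_0)
  define Z' where "Z' = - Z - x * Y'"
  have g: "s_z C (s_y B p) = (x, y0 + Y', z0 + Z')"
    by (simp add: p s_y_def s_z_def B C Y'_def Z'_def Y_def Z_def algebra_simps)
  have "Y' - \<mu> * Z' = \<mu>^2 * (Y - \<mu> * Z)"
    using lx unfolding Z'_def Y'_def by algebra
  then show "eig_a \<mu> y0 z0 (s_z C (s_y B p)) = \<mu>^2 * eig_a \<mu> y0 z0 p"
    unfolding g by (simp add: eig_a_def p Y_def Z_def)
  have "\<mu>^2 * (\<mu> * Y' - Z') = \<mu> * Y - Z"
    using lx unfolding Z'_def Y'_def by algebra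
  then show "\<mu>^2 * eig_b \<mu> y0 z0 (s_z C (s_y B p)) = eig_b \<mu> y0 z0 p"
    unfolding g by (simp add: eig_b_def p Y_def Z_def)
qed

lemma fst_s_y [simp]: "fst (s_y B p) = fst p" and fst_s_z [simp]: "fst (s_z C p) = fst p"
  by (simp_all add: s_y_def s_z_def case_prod_unfold)

lemma fst_iterates [simp]: "fst (((s_z C \<circ> s_y B) ^^ n) p) = fst p" "fst (((s_y B \<circ> s_z C) ^^ n) p) = fst p"
  by (induction n) simp_all

lemma eig_iterates:
  assumes l: "\<mu>^2 + fst p * \<mu> + 1 = 0" and B: "B = 2 * y0 + fst p * z0" and C: "C = 2 * z0 + fst p * y0"
  shows "eig_a \<mu> y0 z0 (((s_z C \<circ> s_y B) ^^ n) p) = (\<mu>^2)^n * eig_a \<mu> y0 z0 p"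
    and "(\<mu>^2)^n * eig_b \<mu> y0 z0 (((s_z C \<circ> s_y B) ^^ n) p) = eig_b \<mu> y0 z0 p"
    and "(\<mu>^2)^n * eig_a \<mu> y0 z0 (((s_y B \<circ> s_z C) ^^ n) p) = eig_a \<mu> y0 z0 p"
    and "eig_b \<mu> y0 z0 (((s_y B \<circ> s_z C) ^^ n) p) = (\<mu>^2)^n * eig_b \<mu> y0 z0 p"
proof (induction n)
  case (Suc n)
  let ?p = "((s_z C \<circ> s_y B) ^^ n) p" and ?q = "((s_y B \<circ> s_z C) ^^ n) p"
  have P: "\<mu>^2 + fst ?p * \<mu> + 1 = 0" "B = 2 * y0 + fst ?p * z0" "C = 2 * z0 + fst ?p * y0"
    using assms by simp_all
  note e = eig_s_z_s_y[OF P]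
  \<comment> \<open>\<open>?q\<close> is the forward image of \<open>?r\<close>, so the forward
    identities at \<open>?r\<close> describe the backward step.\<close>
  let ?r = "s_y B (s_z C ?q)"
  have fr: "fst ?r = fst p"
    by simp
  have R: "\<mu>^2 + fst ?r * \<mu> + 1 = 0" "B = 2 * y0 + fst ?r * z0" "C = 2 * z0 + fst ?r * y0"
    unfolding fr using assms by simp_all
  have e': "eig_a \<mu> y0 z0 ?q = \<mu>^2 * eig_a \<mu> y0 z0 ?r" "\<mu>^2 * eig_b \<mu> y0 z0 ?q = eig_b \<mu> y0 z0 ?r"
    using eig_s_z_s_y[OF R] by (simp_all only: s_y_s_y s_z_s_z)
  show "eig_a \<mu> y0 z0 (((s_z C \<circ> s_y B) ^^ Suc n) p) = (\<mu>^2)^Suc n * eig_a \<mu> y0 z0 p"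
    by (simp only: funpow.simps o_apply e(1) Suc(1) power_Suc mult.assoc)
  show "(\<mu>^2)^Suc n * eig_b \<mu> y0 z0 (((s_z C \<circ> s_y B) ^^ Suc n) p) = eig_b \<mu> y0 z0 p"
    by (simp only: funpow.simps o_apply e(2) Suc(2) power_Suc2 mult.assoc)
  show "(\<mu>^2)^Suc n * eig_a \<mu> y0 z0 (((s_y B \<circ> s_z C) ^^ Suc n) p) = eig_a \<mu> y0 z0 p"
    by (simp only: funpow.simps o_apply e'(1)[symmetric] Suc(3) power_Suc2 mult.assoc)
  show "eig_b \<mu> y0 z0 (((s_y B \<circ> s_z C) ^^ Suc n) p) = (\<mu>^2)^Suc n * eig_b \<mu> y0 z0 p"
    by (simp only: funpow.simps o_apply e'(2)[symmetric] Suc(4) power_Suc mult.assoc)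
qed simp_all

text \<open>Cramer's rule for the centre of the conic, with determinant
  \<open>4 - x^2\<close>.\<close>

lemma fixed_point_exists:
  fixes x B C :: complex
  assumes "x^2 \<noteq> 4"
  obtains y0 z0 where "B = 2 * y0 + x * z0" "C = 2 * z0 + x * y0"
proof
  have n: "4 - x^2 \<noteq> 0" using assms by auto
  show "B = 2 * ((2 * B - x * C) / (4 - x^2)) + x * ((2 * C - x * B) / (4 - x^2))"
    using n by (simp add: divide_simps) (simp add: algebra_simps power2_eq_square)
  show "C = 2 * ((2 * C - x * B) / (4 - x^2)) + x * ((2 * B - x * C) / (4 - x^2))"
    using n by (simp add: divide_simps) (simp add: algebra_simps power2_eq_square)
qed

text \<open>The discriminant is negative, so the roots are conjugate with product 1. The condition
  \<open>\<mu>^2 \<noteq> 1\<close> makes the two eigenfunctionals independent.\<close>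

lemma unimodular_eigenvalue:
  assumes "\<bar>s\<bar> < 2"
  obtains \<mu> where "\<mu>^2 + complex_of_real s * \<mu> + 1 = 0" "norm \<mu> = 1" "\<mu>^2 \<noteq> 1"
proof
  define r where "r = sqrt (4 - s^2)"
  have "s^2 < 2^2" using assms by (intro power2_strict_mono) auto
  then have r: "r > 0" "r^2 = 4 - s^2" by (simp_all add: r_def)
  let ?l = "Complex (- s / 2) (r / 2)"
  show "?l^2 + complex_of_real s * ?l + 1 = 0"
    using r(2) by (simp add: complex_eq_iff power2_eq_square field_simps)
  show "norm ?l = 1"
    using r(2) by (simp add: cmod_def power_divide field_simps)
  show "?l^2 \<noteq> 1"
  proof
    assume "?l^2 = 1"
    then have "?l = 1 \<or> ?l = - 1" by (simp only: power2_eq_1_iff)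
    then have "Im ?l = 0" by (elim disjE) (simp_all only: one_complex.sel uminus_complex.sel minus_zero)
    then show False using r(1) by simp
  qed
qed

text \<open>The roots have product 1. On the unit circle they would be conjugate, making
  \<open>x\<close> minus twice a real part, hence a number in \<open>[-2, 2]\<close>; otherwise one
  of \<open>l\<close>, \<open>1 / l\<close> lies outside.\<close>

lemma expanding_eigenvalue:
  assumes "x \<notin> complex_of_real ` {-2..2}"
  obtains \<mu> where "\<mu>^2 + x * \<mu> + 1 = 0" "norm \<mu> > 1"
proof -
  obtain l where l: "l^2 + x * l + 1 = 0"
    using quadratic_root_near[of 0 x 1 2] by auto
  have l0: "l \<noteq> 0" using l by auto
  have "norm l \<noteq> 1"
  proof
    assume n: "norm l = 1"
    then have "l * cnj l = 1" by (simp add: complex_norm_square[symmetric])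
    then have "l * (l + x + cnj l) = l^2 + x * l + 1"
      by (simp add: algebra_simps power2_eq_square)
    then have "l + x + cnj l = 0" using l l0 by simp
    then have "x = - (l + cnj l)" by (simp add: eq_neg_iff_add_eq_0 algebra_simps)
    also have "\<dots> = complex_of_real (- 2 * Re l)" by (simp add: complex_add_cnj)
    finally have "x = complex_of_real (- 2 * Re l)" .
    moreover have "- 2 * Re l \<in> {-2..2}"
      using abs_Re_le_cmod[of l] n by auto
    ultimately show False using assms by blast
  qed
  then consider "norm l > 1" | "norm l < 1" by linarith
  then show thesis
  proof cases
    case 1
    then show ?thesis using that l by blast
  next
    case 2
    have "(1 / l)^2 + x * (1 / l) + 1 = (l^2 + x * l + 1) / l^2"
      using l0 by (simp add: field_simps power2_eq_square)
    then have "(1 / l)^2 + x * (1 / l) + 1 = 0" by (simp add: l)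
    moreover have "norm (1 / l) > 1" using 2 l0 by (simp add: norm_divide)
    ultimately show ?thesis using that by blast
  qed
qed

text \<open>Two maps, in practice inverse to each other: the expanding direction of one is the
  contracting direction of the other, and a nearby point is only known to have one nonzero
  eigenfunctional.\<close>

definition unstable_at :: "(complex \<times> complex \<times> complex) set \<Rightarrow>
    (complex \<times> complex \<times> complex \<Rightarrow> complex \<times> complex \<times> complex) \<Rightarrow>
    (complex \<times> complex \<times> complex \<Rightarrow> complex \<times> complex \<times> complex) \<Rightarrow> complex \<times> complex \<times> complex \<Rightarrow> bool" where
  "unstable_at S h k p \<longleftrightarrow> bounded (range (\<lambda>n. (h ^^ n) p)) \<and> bounded (range (\<lambda>n. (k ^^ n) p)) \<and>
     (\<forall>e>0. \<exists>q\<in>S. dist q p < e \<and> (filterlim (\<lambda>n. norm ((h ^^ n) q)) at_top sequentially \<or>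
        filterlim (\<lambda>n. norm ((k ^^ n) q)) at_top sequentially))"

text \<open>Recovering the displacements from the eigenfunctionals is a linear system of determinant
  \<open>\<mu>^2 - 1\<close>.\<close>

lemma bounded_of_eig:
  assumes "\<mu>^2 \<noteq> 1" "norm \<mu> = 1" "\<And>n. fst (f n) = x"
    "\<And>n. norm (eig_a \<mu> y0 z0 (f n)) = a" "\<And>n. norm (eig_b \<mu> y0 z0 (f n)) = b"
  shows "bounded (range f)"
proof -
  have "norm (f n) \<le> norm x + (norm y0 + a + (b + a) / norm (\<mu>^2 - 1)) + (norm z0 + (b + a) / norm (\<mu>^2 - 1))" for n
  proof -
    define Y where "Y = fst (snd (f n)) - y0"
    define Z where "Z = snd (snd (f n)) - z0"
    have a: "norm (Y - \<mu> * Z) = a" and b: "norm (\<mu> * Y - Z) = b"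
      using assms(4,5)[of n] by (simp_all add: eig_a_def eig_b_def Y_def Z_def)
    have "(\<mu>^2 - 1) * Z = (\<mu> * Y - Z) - \<mu> * (Y - \<mu> * Z)"
      by (simp add: algebra_simps power2_eq_square)
    then have "norm (\<mu>^2 - 1) * norm Z = norm ((\<mu> * Y - Z) - \<mu> * (Y - \<mu> * Z))"
      by (metis norm_mult)
    also have "\<dots> \<le> b + a"
      using norm_triangle_ineq4[of "\<mu> * Y - Z" "\<mu> * (Y - \<mu> * Z)"] by (simp add: norm_mult assms(2) a b)
    finally have Z: "norm Z \<le> (b + a) / norm (\<mu>^2 - 1)"
      using assms(1) by (simp add: field_simps)
    have Y: "norm Y \<le> a + norm Z"
      using norm_triangle_ineq[of "Y - \<mu> * Z" "\<mu> * Z"] by (simp add: norm_mult assms(2) a)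
    have "norm (fst (snd (f n))) \<le> norm y0 + norm Y" "norm (snd (snd (f n))) \<le> norm z0 + norm Z"
      using norm_triangle_ineq[of y0 Y] norm_triangle_ineq[of z0 Z] by (simp_all add: Y_def Z_def)
    moreover have "norm (f n) \<le> norm x + norm (fst (snd (f n))) + norm (snd (snd (f n)))"
      using norm_triple_le[of "f n"] unfolding assms(3) .
    ultimately show ?thesis using Y Z by linarith
  qed
  then show ?thesis unfolding bounded_iff by blast
qed

text \<open>An affine functional is at most a multiple of the norm plus a constant, so its geometric
  growth forces escape. The coefficients \<open>u\<close>, \<open>v\<close> cover both
  eigenfunctionals.\<close>

lemma filterlim_at_top_of_eig:
  fixes f :: "nat \<Rightarrow> complex \<times> complex \<times> complex" and \<mu> u v :: complex
  assumes "norm \<mu> > 1" "c > 0" "\<And>n. norm (\<mu>^2)^n * c \<le> norm (u * (fst (snd (f n)) - y0) - v * (snd (snd (f n)) - z0))"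
  shows "filterlim (\<lambda>n. norm (f n)) at_top sequentially"
proof -
  define K where "K = norm u + norm v + 1"
  have K: "K > 0" by (simp add: K_def add_nonneg_pos)
  define L where "L = norm u * norm y0 + norm v * norm z0"
  have le: "(norm (\<mu>^2)^n * c - L) / K \<le> norm (f n)" for n
  proof -
    let ?y = "fst (snd (f n))" and ?z = "snd (snd (f n))"
    have "norm ?y \<le> norm (f n)" "norm ?z \<le> norm (f n)"
      by (rule coordinate_le; simp add: coordinates_def)+
    then have "norm u * norm ?y \<le> norm u * norm (f n)" "norm v * norm ?z \<le> norm v * norm (f n)"
      by (auto intro: mult_left_mono)
    moreover have "norm (u * (?y - y0) - v * (?z - z0)) \<le> norm u * (norm ?y + norm y0) + norm v * (norm ?z + norm z0)"
      by (intro order_trans[OF norm_triangle_ineq4] add_mono) (auto simp: norm_mult intro!: mult_left_mono norm_triangle_ineq4)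
    ultimately have "norm (\<mu>^2)^n * c \<le> L + norm (f n) * K"
      using assms(3)[of n] norm_ge_zero[of "f n"]
      unfolding L_def K_def distrib_left distrib_right mult.commute[of "norm (f n)"] by linarith
    then show ?thesis using K by (simp add: divide_le_eq algebra_simps)
  qed
  have "norm (\<mu>^2) > 1"
    using one_less_power[OF assms(1), of 2] by (simp add: norm_power)
  then have "filterlim (\<lambda>n. norm ((\<mu>^2)^n)) at_top sequentially"
    by (intro filterlim_compose[OF filterlim_norm_at_top] filterlim_realpow_sequentially_gt1)
  then have "filterlim (\<lambda>n. norm (\<mu>^2)^n) at_top sequentially"
    by (simp add: norm_power)
  then have "filterlim (\<lambda>n. norm (\<mu>^2)^n * (c / K)) at_top sequentially"
    using assms(2) K by (intro filterlim_at_top_mult_tendsto_pos[OF tendsto_const]) auto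
  then have "filterlim (\<lambda>n. - (L / K) + norm (\<mu>^2)^n * (c / K)) at_top sequentially"
    by (intro filterlim_tendsto_add_at_top[OF tendsto_const])
  then show ?thesis
    by (rule filterlim_at_top_mono) (use le in \<open>auto simp: diff_divide_distrib\<close>)
qed

text \<open>The escaping point has to lie on the surface: \<open>x\<close> and \<open>z\<close> are
  perturbed freely and \<open>surface_lift\<close> supplies \<open>y\<close>.\<close>

lemma unstable_at_x:
  assumes p: "p \<in> surface A B C D" and x: "fst p \<in> complex_of_real ` {-2<..<2}"
  shows "unstable_at (surface A B C D) (s_z C \<circ> s_y B) (s_y B \<circ> s_z C) p"
proof -
  obtain s where s: "fst p = complex_of_real s" "\<bar>s\<bar> < 2" using x by auto
  obtain y z where p_eq: "p = (complex_of_real s, y, z)" using s(1) by (cases p) auto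
  have "s^2 < 2^2" using s(2) by (intro power2_strict_mono) auto
  then have "(complex_of_real s)^2 \<noteq> 4"
  proof -
    have "complex_of_real (s^2) \<noteq> complex_of_real 4"
      unfolding of_real_eq_iff using \<open>s^2 < 2^2\<close> by simp
    then show ?thesis by simp
  qed
  then obtain y0 z0 where yz: "B = 2 * y0 + fst p * z0" "C = 2 * z0 + fst p * y0"
    using fixed_point_exists[of "fst p" B C] s(1) by auto
  obtain l where l: "l^2 + fst p * l + 1 = 0" "norm l = 1" "l^2 \<noteq> 1"
    using unimodular_eigenvalue[OF s(2)] s(1) by auto
  note it = eig_iterates[OF l(1) yz]
  have n1: "norm ((l^2)^n) = 1" for n using l(2) by (simp add: norm_power)
  have "bounded (range (\<lambda>n. ((s_z C \<circ> s_y B) ^^ n) p))"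
  proof (rule bounded_of_eig[OF l(3,2) fst_iterates(1)])
    show "norm (eig_a l y0 z0 (((s_z C \<circ> s_y B) ^^ n) p)) = norm (eig_a l y0 z0 p)" for n
      by (simp only: it(1) norm_mult n1)
    show "norm (eig_b l y0 z0 (((s_z C \<circ> s_y B) ^^ n) p)) = norm (eig_b l y0 z0 p)" for n
      using arg_cong[OF it(2)[of n], of norm] by (simp only: norm_mult n1)
  qed
  moreover have "bounded (range (\<lambda>n. ((s_y B \<circ> s_z C) ^^ n) p))"
  proof (rule bounded_of_eig[OF l(3,2) fst_iterates(2)])
    show "norm (eig_b l y0 z0 (((s_y B \<circ> s_z C) ^^ n) p)) = norm (eig_b l y0 z0 p)" for n
      by (simp only: it(4) norm_mult n1)
    show "norm (eig_a l y0 z0 (((s_y B \<circ> s_z C) ^^ n) p)) = norm (eig_a l y0 z0 p)" for n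
      using arg_cong[OF it(3)[of n], of norm] by (simp only: norm_mult n1)
  qed
  moreover have "\<exists>q\<in>surface A B C D. dist q p < e \<and>
      (filterlim (\<lambda>n. norm (((s_z C \<circ> s_y B) ^^ n) q)) at_top sequentially \<or>
       filterlim (\<lambda>n. norm (((s_y B \<circ> s_z C) ^^ n) q)) at_top sequentially)" if "e > 0" for e
  proof -
    obtain d where d: "d > 0" "\<And>x' z'. dist x' (complex_of_real s) < d \<Longrightarrow> dist z' z < d \<Longrightarrow>
        \<exists>y'. dist y' y < e / 3 \<and> (x', y', z') \<in> surface A B C D"
      using surface_lift[of "complex_of_real s" y z A B C D "e / 3"] p p_eq \<open>e > 0\<close> by auto
    \<comment> \<open>The shifts in \<open>x\<close> and \<open>z\<close> cost at most
      \<open>e / 4\<close> each and the one in \<open>y\<close> less than \<open>e / 3\<close>, in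
      total less than \<open>e\<close>.\<close>
    define \<delta> where "\<delta> = min (d / 2) (e / 4)"
    have \<delta>: "\<delta> > 0" "\<delta> < d" "\<delta> < e / 3" using d(1) \<open>e > 0\<close> by (auto simp: \<delta>_def)
    define x' where "x' = Complex s \<delta>"
    have "x' \<notin> complex_of_real ` {-2..2}" using \<delta>(1) by (auto simp: x'_def complex_eq_iff)
    then obtain m where m: "m^2 + x' * m + 1 = 0" "norm m > 1" by (rule expanding_eigenvalue)
    have "x'^2 \<noteq> 4"
    proof
      assume "x'^2 = 4"
      then have "(x' - 2) * (x' + 2) = 0" by (simp add: algebra_simps power2_eq_square)
      then have "x' = 2 \<or> x' = - 2" by (auto simp: eq_neg_iff_add_eq_0)
      then show False using \<delta>(1) by (auto simp: x'_def complex_eq_iff)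
    qed
    then obtain y1 z1 where yz1: "B = 2 * y1 + x' * z1" "C = 2 * z1 + x' * y1"
      by (rule fixed_point_exists)
    \<comment> \<open>Avoiding \<open>z1\<close> suffices, whatever \<open>y'\<close> turns out to
      be: \<open>eig_b - m * eig_a\<close> equals \<open>(m^2 - 1) * (z' - z1)\<close>.\<close>
    define z' where "z' = (if z = z1 then z + of_real \<delta> else z)"
    have z': "z' \<noteq> z1" "dist z' z \<le> \<delta>" using \<delta>(1) by (auto simp: z'_def dist_norm)
    have "x' - complex_of_real s = \<i> * of_real \<delta>" by (simp add: x'_def complex_eq_iff)
    then have dx: "dist x' (complex_of_real s) = \<delta>" using \<delta>(1) by (simp add: dist_norm norm_mult)
    then obtain y' where y': "dist y' y < e / 3" "(x', y', z') \<in> surface A B C D"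
      using d(2)[of x' z'] z'(2) \<delta> by auto
    let ?q = "(x', y', z')"
    have "dist ?q p \<le> dist x' (of_real s) + dist (y', z') (y, z)"
      unfolding p_eq dist_Pair_Pair[of x'] by (rule sqrt_sum_squares_le_sum) auto
    moreover have "dist (y', z') (y, z) \<le> dist y' y + dist z' z"
      unfolding dist_Pair_Pair by (rule sqrt_sum_squares_le_sum) auto
    ultimately have dq: "dist ?q p < e" using dx y'(1) z'(2) \<delta> by linarith
    have P: "m^2 + fst ?q * m + 1 = 0" "B = 2 * y1 + fst ?q * z1" "C = 2 * z1 + fst ?q * y1"
      using m(1) yz1 by simp_all
    note it' = eig_iterates[OF P]
    have m2: "m^2 \<noteq> 1"
    proof
      assume "m^2 = 1"
      then have "norm m = 1" by (auto simp: power2_eq_1_iff)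
      then show False using m(2) by simp
    qed
    have "eig_a m y1 z1 ?q \<noteq> 0 \<or> eig_b m y1 z1 ?q \<noteq> 0"
    proof (rule ccontr)
      assume "\<not> ?thesis"
      then have "eig_b m y1 z1 ?q - m * eig_a m y1 z1 ?q = 0" by simp
      moreover have "eig_b m y1 z1 ?q - m * eig_a m y1 z1 ?q = (m^2 - 1) * (z' - z1)"
        by (simp add: eig_a_def eig_b_def algebra_simps power2_eq_square)
      ultimately show False using m2 z'(1) by simp
    qed
    then have "filterlim (\<lambda>n. norm (((s_z C \<circ> s_y B) ^^ n) ?q)) at_top sequentially \<or>
       filterlim (\<lambda>n. norm (((s_y B \<circ> s_z C) ^^ n) ?q)) at_top sequentially"
    proof (elim disjE)
      assume a: "eig_a m y1 z1 ?q \<noteq> 0"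
      have "filterlim (\<lambda>n. norm (((s_z C \<circ> s_y B) ^^ n) ?q)) at_top sequentially"
      proof (rule filterlim_at_top_of_eig[OF m(2), where u = 1 and v = m and ?y0.0 = y1 and ?z0.0 = z1])
        show "norm (eig_a m y1 z1 ?q) > 0" using a by simp
        show "norm (m^2)^n * norm (eig_a m y1 z1 ?q) \<le>
          norm (1 * (fst (snd (((s_z C \<circ> s_y B) ^^ n) ?q)) - y1) - m * (snd (snd (((s_z C \<circ> s_y B) ^^ n) ?q)) - z1))" for n
          using arg_cong[OF it'(1)[of n], of norm] unfolding eig_a_def[of _ _ _ "(_ ^^ _) _"]
          by (simp add: norm_mult norm_power)
      qed
      then show ?thesis ..
    next
      assume b: "eig_b m y1 z1 ?q \<noteq> 0"
      have "filterlim (\<lambda>n. norm (((s_y B \<circ> s_z C) ^^ n) ?q)) at_top sequentially"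
      proof (rule filterlim_at_top_of_eig[OF m(2), where u = m and v = 1 and ?y0.0 = y1 and ?z0.0 = z1])
        show "norm (eig_b m y1 z1 ?q) > 0" using b by simp
        show "norm (m^2)^n * norm (eig_b m y1 z1 ?q) \<le>
          norm (m * (fst (snd (((s_y B \<circ> s_z C) ^^ n) ?q)) - y1) - 1 * (snd (snd (((s_y B \<circ> s_z C) ^^ n) ?q)) - z1))" for n
          using arg_cong[OF it'(4)[of n], of norm] unfolding eig_b_def[of _ _ _ "(_ ^^ _) _"]
          by (simp add: norm_mult norm_power)
      qed
      then show ?thesis ..
    qed
    then show ?thesis using y'(2) dq by blast
  qed
  ultimately show ?thesis unfolding unstable_at_def by blast
qed

section \<open>Instability in every coordinate and along group orbits\<close>

lemma unstable_at_rot: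
  assumes "\<And>p. rot (h p) = h' (rot p)" "\<And>p. rot (k p) = k' (rot p)"
    and u: "unstable_at (surface B C A D) h' k' (rot p)"
  shows "unstable_at (surface A B C D) h k p"
proof -
  have pow: "(h' ^^ n) (rot q) = rot ((h ^^ n) q)" "(k' ^^ n) (rot q) = rot ((k ^^ n) q)" for n q
    by (induction n) (simp_all add: assms(1,2))
  have "bounded (range (\<lambda>n. (h ^^ n) p))" "bounded (range (\<lambda>n. (k ^^ n) p))"
    using u by (simp_all add: unstable_at_def pow bounded_iff)
  moreover have "\<exists>q\<in>surface A B C D. dist q p < e \<and> (filterlim (\<lambda>n. norm ((h ^^ n) q)) at_top sequentially \<or>
        filterlim (\<lambda>n. norm ((k ^^ n) q)) at_top sequentially)" if "e > 0" for e
  proof -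
    obtain q where "q \<in> surface B C A D" "dist q (rot p) < e" "filterlim (\<lambda>n. norm ((h' ^^ n) q)) at_top sequentially \<or>
        filterlim (\<lambda>n. norm ((k' ^^ n) q)) at_top sequentially"
      using u \<open>e > 0\<close> unfolding unstable_at_def by blast
    moreover obtain q0 where "q = rot q0" by (metis rot_rot_rot)
    ultimately show ?thesis
      by (intro bexI[of _ q0]) (simp_all add: pow rot_surface)
  qed
  ultimately show ?thesis unfolding unstable_at_def by blast
qed

lemma unstable_at_coordinate:
  assumes p: "p \<in> surface A B C D" and c: "c \<in> coordinates" "c p \<in> complex_of_real ` {-2<..<2}"
  shows "\<exists>h\<in>moves A B C. \<exists>k\<in>moves A B C. unstable_at (surface A B C D) h k p"
proof -
  have y: "unstable_at (surface A B C D) (s_x A \<circ> s_z C) (s_z C \<circ> s_x A) p"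
    if "p \<in> surface A B C D" "fst (snd p) \<in> complex_of_real ` {-2<..<2}" for p A B C
    by (rule unstable_at_rot[OF _ _ unstable_at_x])
      (use that in \<open>simp_all add: rot_s_x rot_s_z rot_surface\<close>)
  have z: "unstable_at (surface A B C D) (s_y B \<circ> s_x A) (s_x A \<circ> s_y B) p"
    if "snd (snd p) \<in> complex_of_real ` {-2<..<2}"
    by (rule unstable_at_rot[OF _ _ y])
      (use that p in \<open>simp_all add: rot_s_x rot_s_y rot_surface\<close>)
  from c consider "fst p \<in> complex_of_real ` {-2<..<2}" | "fst (snd p) \<in> complex_of_real ` {-2<..<2}"
    | "snd (snd p) \<in> complex_of_real ` {-2<..<2}"
    by (auto simp: coordinates_def)
  then show ?thesis
    by cases (use unstable_at_x[OF p] y[OF p] z in \<open>auto simp: moves_def\<close>)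
qed

text \<open>Both alternatives of normality fail: the bounded orbit of \<open>p\<close> excludes
  convergence to infinity, and a nearby escaping point has no subsequence of its orbit that
  converges even pointwise.\<close>

lemma julia_of_unstable:
  assumes p: "p \<in> surface A B C D" and g: "g \<in> aut_group A B C D"
    and hk: "h \<in> moves A B C" "k \<in> moves A B C" and u: "unstable_at (surface A B C D) h k p"
  shows "g p \<in> julia_set A B C D"
proof (rule ccontr)
  let ?S = "surface A B C D"
  assume "g p \<notin> julia_set A B C D"
  then have "g p \<in> fatou_set A B C D"
    using aut_group_surface[OF g p] by (simp add: julia_set_def)
  then obtain U where U: "openin (top_of_set ?S) U" "g p \<in> U" "normal_family_on ?S (aut_group A B C D) U"
    unfolding fatou_set_def by blast
  obtain g' where g': "g' \<in> aut_group A B C D" "\<And>q. q \<in> ?S \<Longrightarrow> g' (g q) = q"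
    using aut_group_inverse[OF g] by metis
  obtain e1 where e1: "e1 > 0" "\<And>w. w \<in> ?S \<Longrightarrow> dist w (g p) < e1 \<Longrightarrow> w \<in> U"
    using U(1,2) unfolding openin_euclidean_subtopology_iff by metis
  obtain e2 where e2: "e2 > 0" "\<And>q. q \<in> ?S \<Longrightarrow> dist q p < e2 \<Longrightarrow> dist (g q) (g p) < e1"
    using continuous_on_aut_group[OF g] e1(1) p unfolding continuous_on_iff by metis
  obtain q where q: "q \<in> ?S" "dist q p < e2" and esc: "filterlim (\<lambda>n. norm ((h ^^ n) q)) at_top sequentially \<or>
        filterlim (\<lambda>n. norm ((k ^^ n) q)) at_top sequentially"
    using u e2(1) unfolding unstable_at_def by blast
  have gq: "g q \<in> U" using e1(2) e2(2) q aut_group_surface[OF g] by blast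
  obtain j where j: "j \<in> moves A B C" "bounded (range (\<lambda>n. (j ^^ n) p))"
    "filterlim (\<lambda>n. norm ((j ^^ n) q)) at_top sequentially"
    using esc hk u unfolding unstable_at_def by blast
  \<comment> \<open>Undoing \<open>g\<close> first lets the sequence act at \<open>g p\<close> as
    the iterates of \<open>j\<close> act at \<open>p\<close>.\<close>
  define f where "f = (\<lambda>n. compose ?S (restrict (j ^^ n) ?S) g')"
  have fG: "range f \<subseteq> aut_group A B C D"
    unfolding f_def using aut_group_compose[OF aut_group_moves_pow[OF j(1)] g'(1)] by blast
  have f: "f n (g w) = (j ^^ n) w" if "w \<in> ?S" for n w
    using aut_group_surface[OF g that] g'(2)[OF that] that by (simp add: f_def compose_def)
  obtain r where r: "strict_mono r" and lim: "converges_uniformly_on_compacts (f \<circ> r) U \<or> converges_to_infinity_on ?S (f \<circ> r) U"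
    using U(3) fG unfolding normal_family_on_def by blast
  from lim show False
  proof
    assume "converges_uniformly_on_compacts (f \<circ> r) U"
    then obtain l where "uniform_limit {g q} (f \<circ> r) l sequentially"
      unfolding converges_uniformly_on_compacts_def using gq by (metis compact_sing empty_subsetI insert_subset)
    then have "(\<lambda>n. (f \<circ> r) n (g q)) \<longlonglongrightarrow> l (g q)"
      by (rule tendsto_uniform_limitI) simp
    then have "(\<lambda>n. norm ((j ^^ r n) q)) \<longlonglongrightarrow> norm (l (g q))"
      using tendsto_norm by (fastforce simp: f[OF q(1)])
    moreover have "filterlim (\<lambda>n. norm ((j ^^ r n) q)) at_top sequentially"
      by (rule filterlim_compose[OF j(3) filterlim_subseq[OF r]])
    ultimately show False
      using not_tendsto_and_filterlim_at_infinity[of sequentially] filterlim_at_top_imp_at_infinity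
        trivial_limit_sequentially by blast
  next
    assume inf: "converges_to_infinity_on ?S (f \<circ> r) U"
    obtain R where R: "\<And>n. norm ((j ^^ n) p) \<le> R" using j(2) by (auto simp: bounded_iff)
    have "compact (?S \<inter> cball 0 R)" using closed_surface by (intro closed_Int_compact) auto
    then have "finite {i. (f \<circ> r) i ` {g p} \<inter> (?S \<inter> cball 0 R) \<noteq> {}}"
      using inf U(2) unfolding converges_to_infinity_on_def by (metis Int_lower1 compact_sing empty_subsetI insert_subset)
    moreover have "(f \<circ> r) i (g p) \<in> ?S \<inter> cball 0 R" for i
    proof -
      have "f (r i) (g p) \<in> ?S"
        using fG by (intro aut_group_surface[OF _ aut_group_surface[OF g p]]) blast
      then show ?thesis
        using R f[OF p] by simp
    qed
    ultimately show False by simp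
  qed
qed

subsection \<open>Connectedness of the real slabs\<close>

definition slab :: "complex \<Rightarrow> complex \<Rightarrow> complex \<Rightarrow> complex \<Rightarrow> (complex \<times> complex \<times> complex \<Rightarrow> complex) \<Rightarrow> (complex \<times> complex \<times> complex) set" where
  "slab A B C D c = {p \<in> surface A B C D. c p \<in> complex_of_real ` {-2<..<2}}"

definition slabs :: "complex \<Rightarrow> complex \<Rightarrow> complex \<Rightarrow> complex \<Rightarrow> (complex \<times> complex \<times> complex) set" where
  "slabs A B C D = (\<Union>c\<in>coordinates. slab A B C D c)"

text \<open>Fibres may degenerate to two crossing lines. The part with \<open>a \<noteq> 0\<close>
  is a graph over \<open>T\<close> times the punctured plane, hence connected, and the crossing
  points are limits of it; exchanging \<open>a\<close> and \<open>b\<close> gives the rest.\<close>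

lemma connected_family_of_hyperbolas:
  fixes c :: "real \<Rightarrow> complex"
  assumes T: "connected T" "t \<in> T" and c: "continuous_on T c"
  shows "connected {(s, a, b). s \<in> T \<and> a * b = c s}"
proof -
  define A1 where "A1 = (\<lambda>(s, a). (s, a, c s / a)) ` (T \<times> - {0})"
  define A0 where "A0 = {(s, a, b). s \<in> T \<and> a = (0::complex) \<and> b = (0::complex) \<and> c s = 0}"
  define sw where "sw = (\<lambda>(s::real, a::complex, b::complex). (s, b, a))"
  have "connected (- {0::complex})"
    by (rule connected_punctured_universe) simp
  with T(1) have "connected (T \<times> - {0::complex})"
    by (rule connected_Times)
  moreover have "continuous_on (T \<times> - {0}) (\<lambda>w. c (fst w))"
    by (rule continuous_on_compose2[OF c]) (auto intro: continuous_on_fst)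
  then have "continuous_on (T \<times> - {0}) (\<lambda>(s, a). (s, a, c s / a))"
    unfolding case_prod_unfold by (intro continuous_on_Pair continuous_on_divide continuous_on_fst continuous_on_snd
        continuous_on_id) auto
  ultimately have "connected A1"
    unfolding A1_def by (intro connected_continuous_image)
  moreover have "A0 \<subseteq> closure A1"
  proof
    fix w assume "w \<in> A0"
    then obtain s where s: "w = (s, 0, 0)" "s \<in> T" "c s = 0" by (auto simp: A0_def)
    show "w \<in> closure A1"
      unfolding closure_approachable
    proof (intro allI impI)
      fix e :: real assume "e > 0"
      have "(s, complex_of_real (e / 2), 0) \<in> A1"
        unfolding A1_def using s \<open>e > 0\<close> by (intro image_eqI[of _ _ "(s, complex_of_real (e / 2))"]) auto
      moreover have "dist (s, complex_of_real (e / 2), 0 :: complex) w < e"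
        using \<open>e > 0\<close> by (simp add: s(1) dist_Pair_Pair)
      ultimately show "\<exists>y\<in>A1. dist y w < e" by blast
    qed
  qed
  ultimately have A: "connected (A1 \<union> A0)"
    by (rule connected_intermediate_closure[OF _ Un_upper1 Un_least[OF closure_subset]])
  have "continuous_on (A1 \<union> A0) sw"
    unfolding sw_def case_prod_unfold by (intro continuous_intros)
  then have B: "connected (sw ` (A1 \<union> A0))"
    using A by (rule connected_continuous_image)
  \<comment> \<open>A common point over \<open>t\<close>: the crossing point if the fibre is
    degenerate, otherwise a point with both coordinates nonzero.\<close>
  have "(A1 \<union> A0) \<inter> sw ` (A1 \<union> A0) \<noteq> {}"
  proof (cases "c t = 0")
    case True
    then have t: "(t, 0, 0) \<in> A0" using T(2) by (simp add: A0_def)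
    have "(t, 0, 0) \<in> sw ` (A1 \<union> A0)"
      using t by (intro image_eqI[of _ _ "(t, 0, 0)"]) (simp_all add: sw_def)
    then show ?thesis using t by blast
  next
    case False
    have t: "(t, 1, c t) \<in> A1"
      unfolding A1_def using T(2) by (intro image_eqI[of _ _ "(t, 1)"]) simp_all
    have "(t, c t, 1) \<in> A1"
      unfolding A1_def using T(2) False by (intro image_eqI[of _ _ "(t, c t)"]) simp_all
    then have "(t, 1, c t) \<in> sw ` (A1 \<union> A0)"
      by (intro image_eqI[of _ _ "(t, c t, 1)"]) (simp_all add: sw_def)
    then show ?thesis using t by blast
  qed
  with A B have "connected ((A1 \<union> A0) \<union> sw ` (A1 \<union> A0))"
    by (rule connected_Un)
  moreover have "(A1 \<union> A0) \<union> sw ` (A1 \<union> A0) = {(s, a, b). s \<in> T \<and> a * b = c s}" (is "?L = ?R")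
  proof
    have R: "A1 \<union> A0 \<subseteq> ?R" by (auto simp: A1_def A0_def)
    moreover have "sw ` ?R \<subseteq> ?R" by (auto simp: sw_def mult.commute)
    then have "sw ` (A1 \<union> A0) \<subseteq> ?R" by (rule order_trans[OF image_mono[OF R]])
    ultimately show "?L \<subseteq> ?R" by (rule Un_least)
    show "?R \<subseteq> ?L"
    proof
      fix w assume "w \<in> ?R"
      then obtain s a b where w: "w = (s, a, b)" "s \<in> T" "a * b = c s" by auto
      consider "a \<noteq> 0" | "b \<noteq> 0" | "a = 0" "b = 0" by blast
      then show "w \<in> ?L"
      proof cases
        case 1
        then have "b = c s / a" using w(3) by (simp add: eq_divide_eq mult.commute)
        then have "w \<in> A1"
          unfolding A1_def w(1) using w(2) 1 by (intro image_eqI[of _ _ "(s, a)"]) auto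
        then show ?thesis by blast
      next
        case 2
        then have "a = c s / b" using w(3) by (simp add: eq_divide_eq)
        then have "(s, b, a) \<in> A1"
          unfolding A1_def using w(2) 2 by (intro image_eqI[of _ _ "(s, b)"]) auto
        then have "sw (s, b, a) \<in> ?L" by blast
        then show ?thesis by (simp add: sw_def w(1))
      next
        case 3
        then have "w \<in> A0" using w by (simp add: A0_def)
        then show ?thesis by blast
      qed
    qed
  qed
  ultimately show ?thesis by simp
qed

text \<open>Centred at the fixed point \<open>(y\<^sub>0, z\<^sub>0)\<close> and in the eigencoordinates \<open>a\<close>, \<open>b\<close>, the conic
  over \<open>x = s\<close> becomes the hyperbola \<open>a b = const\<close>.\<close>

lemma connected_slab_fst: "connected (slab A B C D fst)"
proof -
  let ?T = "{-2<..<2::real}"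
  define y0 where "y0 = (\<lambda>s. (2 * B - of_real s * C) / (4 - (of_real s)^2) :: complex)"
  define z0 where "z0 = (\<lambda>s. (2 * C - of_real s * B) / (4 - (of_real s)^2) :: complex)"
  \<comment> \<open>Minus the defining polynomial at the centre, simplified by the centre equations;
    it vanishes when the conic degenerates.\<close>
  define c where "c = (\<lambda>s. D + A * of_real s - (of_real s)^2 + ((y0 s)^2 + (z0 s)^2 + of_real s * y0 s * z0 s))"
  \<comment> \<open>An explicit branch, continuous in \<open>s\<close>. Its conjugate is its
    inverse, so \<open>Y - cnj (\<mu> s) * Z\<close> below is a multiple of the second
    eigenfunctional.\<close>
  define \<mu> where "\<mu> = (\<lambda>s. complex_of_real (- s / 2) + \<i> * complex_of_real (sqrt (4 - s^2) / 2))"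
  have n4: "4 - (complex_of_real s)^2 \<noteq> 0" if "s \<in> ?T" for s
  proof -
    have "\<bar>s\<bar>^2 < 2^2" using that by (intro power2_strict_mono) auto
    then have "complex_of_real (4 - s^2) \<noteq> 0" unfolding of_real_eq_0_iff by simp
    then show ?thesis by simp
  qed
  have center: "B = 2 * y0 s + of_real s * z0 s" "C = 2 * z0 s + of_real s * y0 s" if "s \<in> ?T" for s
    using n4[OF that] unfolding y0_def z0_def
    by (simp add: divide_simps, simp add: algebra_simps power2_eq_square)+
  have mu: "\<mu> s * cnj (\<mu> s) = 1" "\<mu> s + cnj (\<mu> s) = - of_real s" "cnj (\<mu> s) - \<mu> s \<noteq> 0" if "s \<in> ?T" for s
  proof -
    have "\<bar>s\<bar>^2 < 2^2" using that by (intro power2_strict_mono) auto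
    then have r: "sqrt (4 - s^2) > 0" "(sqrt (4 - s^2))^2 = 4 - s^2" by simp_all
    show "\<mu> s * cnj (\<mu> s) = 1"
      using r(2) by (simp add: \<mu>_def complex_eq_iff power2_eq_square field_simps)
    show "\<mu> s + cnj (\<mu> s) = - of_real s" by (simp add: \<mu>_def complex_eq_iff)
    show "cnj (\<mu> s) - \<mu> s \<noteq> 0" using r(1) by (simp add: \<mu>_def complex_eq_iff)
  qed
  have surf: "(of_real s, y0 s + Y, z0 s + Z) \<in> surface A B C D \<longleftrightarrow>
      (Y - \<mu> s * Z) * (Y - cnj (\<mu> s) * Z) = c s" if "s \<in> ?T" for s Y Z
  proof -
    have "(Y - \<mu> s * Z) * (Y - cnj (\<mu> s) * Z) = Y^2 - (\<mu> s + cnj (\<mu> s)) * Y * Z + (\<mu> s * cnj (\<mu> s)) * Z^2"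
      by (simp add: algebra_simps power2_eq_square)
    also have "\<dots> = Y^2 + of_real s * Y * Z + Z^2" unfolding mu(1,2)[OF that] by simp
    finally have q: "(Y - \<mu> s * Z) * (Y - cnj (\<mu> s) * Z) = Y^2 + of_real s * Y * Z + Z^2" .
    define x where "x = complex_of_real s"
    define y1 where "y1 = y0 s"
    define z1 where "z1 = z0 s"
    have BC: "B = 2 * y1 + x * z1" "C = 2 * z1 + x * y1"
      using center[OF that] by (simp_all add: x_def y1_def z1_def)
    have "x^2 + (y1 + Y)^2 + (z1 + Z)^2 + x * (y1 + Y) * (z1 + Z) - (A * x + B * (y1 + Y) + C * (z1 + Z) + D) =
      (Y^2 + x * Y * Z + Z^2) - (D + A * x - x^2 + (y1^2 + z1^2 + x * y1 * z1))"
      unfolding BC by (simp add: algebra_simps power2_eq_square)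
    then have "(x^2 + (y1 + Y)^2 + (z1 + Z)^2 + x * (y1 + Y) * (z1 + Z) = A * x + B * (y1 + Y) + C * (z1 + Z) + D) \<longleftrightarrow>
      Y^2 + x * Y * Z + Z^2 = D + A * x - x^2 + (y1^2 + z1^2 + x * y1 * z1)"
      by (metis (no_types, lifting) eq_iff_diff_eq_0)
    then show ?thesis
      unfolding q by (simp add: surface_def c_def x_def y1_def z1_def)
  qed
  \<comment> \<open>The inverse of passing from \<open>Y\<close>, \<open>Z\<close> to
    \<open>a = Y - \<mu> s * Z\<close>, \<open>b = Y - cnj (\<mu> s) * Z\<close>; subtracting the
    two recovers \<open>Z\<close>.\<close>
  define \<Phi> where "\<Phi> = (\<lambda>(s, a, b). let Z = (a - b) / (cnj (\<mu> s) - \<mu> s) in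
      (complex_of_real s, y0 s + (a + \<mu> s * Z), z0 s + Z))"
  let ?W = "{(s, a, b). s \<in> ?T \<and> a * b = c s}"
  have cont: "continuous_on ?T y0" "continuous_on ?T z0" "continuous_on ?T \<mu>"
    unfolding y0_def z0_def \<mu>_def using n4 by (intro continuous_intros; auto)+
  then have contc: "continuous_on ?T c"
    unfolding c_def by (intro continuous_intros)
  have W: "connected ?W"
    by (rule connected_family_of_hyperbolas[OF _ _ contc, of 0]) auto
  have "continuous_on ?W \<Phi>"
  proof -
    have f: "continuous_on ?W fst" "fst ` ?W \<subseteq> ?T" by (auto intro: continuous_intros)
    have "continuous_on ?W (\<lambda>w. y0 (fst w))" "continuous_on ?W (\<lambda>w. z0 (fst w))" "continuous_on ?W (\<lambda>w. \<mu> (fst w))"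
      by (rule continuous_on_compose2[OF _ f]; fact cont)+
    then show ?thesis
      unfolding \<Phi>_def case_prod_unfold Let_def using mu(3)
      by (intro continuous_intros) auto
  qed
  then have "connected (\<Phi> ` ?W)"
    using W by (rule connected_continuous_image)
  moreover have "\<Phi> ` ?W = slab A B C D fst"
  proof
    show "\<Phi> ` ?W \<subseteq> slab A B C D fst"
    proof
      fix p assume "p \<in> \<Phi> ` ?W"
      then obtain s a b where s: "s \<in> ?T" "a * b = c s" and p: "p = \<Phi> (s, a, b)" by auto
      define Z where "Z = (a - b) / (cnj (\<mu> s) - \<mu> s)"
      have "(a + \<mu> s * Z) - \<mu> s * Z = a" by simp
      moreover have "(a + \<mu> s * Z) - cnj (\<mu> s) * Z = b"
      proof -
        have "(cnj (\<mu> s) - \<mu> s) * Z = a - b" using mu(3)[OF s(1)] by (simp add: Z_def)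
        then show ?thesis by (simp add: algebra_simps)
      qed
      ultimately have "(of_real s, y0 s + (a + \<mu> s * Z), z0 s + Z) \<in> surface A B C D"
        using s by (simp only: surf[OF s(1)])
      moreover have "p = (of_real s, y0 s + (a + \<mu> s * Z), z0 s + Z)"
        by (simp add: p \<Phi>_def Z_def Let_def)
      ultimately show "p \<in> slab A B C D fst" using s(1) by (simp add: slab_def)
    qed
    show "slab A B C D fst \<subseteq> \<Phi> ` ?W"
    proof
      fix p assume "p \<in> slab A B C D fst"
      then have pS: "p \<in> surface A B C D" and px: "fst p \<in> complex_of_real ` ?T"
        by (auto simp: slab_def)
      then obtain s where s: "s \<in> ?T" "fst p = of_real s" by auto
      define Y where "Y = fst (snd p) - y0 s"
      define Z where "Z = snd (snd p) - z0 s"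
      have p: "p = (of_real s, y0 s + Y, z0 s + Z)" using s(2) by (cases p) (auto simp: Y_def Z_def)
      let ?a = "Y - \<mu> s * Z" and ?b = "Y - cnj (\<mu> s) * Z"
      have "(s, ?a, ?b) \<in> ?W" using pS s(1) surf[OF s(1), of Y Z] by (simp add: p)
      moreover have "\<Phi> (s, ?a, ?b) = p"
      proof -
        have "?a - ?b = (cnj (\<mu> s) - \<mu> s) * Z" by (simp add: algebra_simps)
        then have eq: "(?a - ?b) / (cnj (\<mu> s) - \<mu> s) = Z" using mu(3)[OF s(1)] by simp
        show ?thesis
          unfolding \<Phi>_def prod.case Let_def eq by (simp add: p)
      qed
      ultimately show "p \<in> \<Phi> ` ?W" by (metis (no_types, lifting) imageI)
    qed
  qed
  ultimately show ?thesis by simp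
qed

lemma rot_image_slab: "rot ` slab A B C D (\<lambda>p. c (rot p)) = slab B C A D c"
proof
  show "rot ` slab A B C D (\<lambda>p. c (rot p)) \<subseteq> slab B C A D c"
    by (auto simp: slab_def rot_surface)
  show "slab B C A D c \<subseteq> rot ` slab A B C D (\<lambda>p. c (rot p))"
  proof
    fix p assume "p \<in> slab B C A D c"
    then have "rot (rot p) \<in> slab A B C D (\<lambda>p. c (rot p))"
      by (simp add: slab_def rot_surface)
    then show "p \<in> rot ` slab A B C D (\<lambda>p. c (rot p))"
      using imageI[of "rot (rot p)" _ rot] by fastforce
  qed
qed

lemma connected_slab:
  assumes "c \<in> coordinates"
  shows "connected (slab A B C D c)"
proof -
  have z: "connected (slab A B C D (\<lambda>p. snd (snd p)))" for A B C D
    using connected_continuous_image[OF continuous_on_rot connected_slab_fst[of C A B D]]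
      rot_image_slab[of C A B D "\<lambda>p. snd (snd p)"] by simp
  have y: "connected (slab A B C D (\<lambda>p. fst (snd p)))"
    using connected_continuous_image[OF continuous_on_rot z[of C A B D]]
      rot_image_slab[of C A B D "\<lambda>p. fst (snd p)"] by simp
  show ?thesis
    using assms y z connected_slab_fst by (auto simp: coordinates_def)
qed

lemma quadratic_root_exists:
  fixes b c :: complex
  obtains y where "y^2 + b * y + c = 0"
proof -
  have "norm c < (norm c + 1)^2"
    by (simp add: power2_eq_square algebra_simps add_pos_nonneg add_nonneg_pos)
  then show thesis
    using quadratic_root_near[of 0 b c "norm c + 1"] that by (auto simp: add_nonneg_pos)
qed

lemma zero_in_interval: "0 \<in> complex_of_real ` {-2<..<2}" and one_in_interval: "1 \<in> complex_of_real ` {-2<..<2}"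
  by (auto intro: image_eqI[of _ _ 0] image_eqI[of _ _ 1])

text \<open>A point with two vanishing coordinates lies in two slabs, and its third coordinate only
  has to solve a quadratic equation. Two such points link the three slabs.\<close>

lemma connected_slabs: "connected (slabs A B C D)" and slabs_nonempty: "slabs A B C D \<noteq> {}"
  and slab_nonempty: "c \<in> coordinates \<Longrightarrow> slab A B C D c \<noteq> {}"
proof -
  obtain z where z: "z^2 + (- C) * z + (- D) = 0" by (rule quadratic_root_exists)
  obtain x where x: "x^2 + (- A) * x + (- D) = 0" by (rule quadratic_root_exists)
  have Z: "(0, 0, z) \<in> surface A B C D" and X: "(x, 0, 0) \<in> surface A B C D"
    using z x by (simp_all add: surface_def algebra_simps)
  have XY: "(0, 0, z) \<in> slab A B C D fst \<inter> slab A B C D (\<lambda>p. fst (snd p))"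
    using Z zero_in_interval by (simp add: slab_def)
  have YZ: "(x, 0, 0) \<in> slab A B C D (\<lambda>p. fst (snd p)) \<inter> slab A B C D (\<lambda>p. snd (snd p))"
    using X zero_in_interval by (simp add: slab_def)
  have eq: "slabs A B C D = (slab A B C D fst \<union> slab A B C D (\<lambda>p. fst (snd p))) \<union> slab A B C D (\<lambda>p. snd (snd p))"
    by (auto simp: slabs_def coordinates_def)
  show "connected (slabs A B C D)"
    unfolding eq by (intro connected_Un connected_slab) (use XY YZ in \<open>auto simp: coordinates_def\<close>)
  show "slabs A B C D \<noteq> {}" using XY eq by blast
  show "slab A B C D c \<noteq> {}" if "c \<in> coordinates"
    using that XY YZ unfolding coordinates_def by blast
qed

subsection \<open>The orbit of the slabs\<close>

definition slab_orbit :: "complex \<Rightarrow> complex \<Rightarrow> complex \<Rightarrow> complex \<Rightarrow> (complex \<times> complex \<times> complex) set" where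
  "slab_orbit A B C D = (\<Union>g\<in>aut_group A B C D. g ` slabs A B C D)"

lemma slabs_subset_surface: "slabs A B C D \<subseteq> surface A B C D"
  by (auto simp: slabs_def slab_def)

lemmas slabs_surface = subsetD[OF slabs_subset_surface]

lemma slabs_subset_orbit: "slabs A B C D \<subseteq> slab_orbit A B C D"
proof
  fix p assume p: "p \<in> slabs A B C D"
  then have "restrict (\<lambda>p. p) (surface A B C D) p = p" using slabs_surface by auto
  then show "p \<in> slab_orbit A B C D"
    unfolding slab_orbit_def using p aut_group_id by (metis UN_I imageI)
qed

lemma slab_orbit_subset_surface: "slab_orbit A B C D \<subseteq> surface A B C D"
  unfolding slab_orbit_def using slabs_subset_surface aut_group_surface by blast

lemma aut_group_slab_orbit:
  assumes "g \<in> aut_group A B C D" "p \<in> slab_orbit A B C D"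
  shows "g p \<in> slab_orbit A B C D"
proof -
  obtain f q where f: "f \<in> aut_group A B C D" "q \<in> slabs A B C D" "p = f q"
    using assms(2) unfolding slab_orbit_def by blast
  have "g p = compose (surface A B C D) g f q"
    using f slabs_surface[OF f(2)] by (simp add: compose_def)
  then show ?thesis
    unfolding slab_orbit_def using aut_group_compose[OF assms(1) f(1)] f(2) by blast
qed

lemma slab_orbit_of_image:
  assumes "g \<in> aut_group A B C D" "p \<in> surface A B C D" "g p \<in> slabs A B C D"
  shows "p \<in> slab_orbit A B C D"
proof -
  obtain g' where g': "g' \<in> aut_group A B C D" "g' (g p) = p"
    using aut_group_inverse[OF assms(1)] assms(2) by metis
  then show ?thesis
    using aut_group_slab_orbit[OF g'(1), of "g p"] assms(3) slabs_subset_orbit by force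
qed

lemma moves_preserve_coordinate:
  assumes "h \<in> moves A B C"
  shows "\<exists>c\<in>coordinates. \<forall>p. c (h p) = c p"
  using assms by (auto simp: moves_def coordinates_def s_x_def s_y_def s_z_def case_prod_unfold)

text \<open>A generator preserves one of the three slabs, so it moves the connected set \<open>slabs\<close> to one
  that meets it; a word in the generators yields a chain of such sets.\<close>

lemma connected_chain:
  assumes "g \<in> aut_group A B C D"
  shows "\<exists>T. connected T \<and> slabs A B C D \<subseteq> T \<and> g ` slabs A B C D \<subseteq> T \<and> T \<subseteq> slab_orbit A B C D"
  using assms
proof (induction rule: aut_group_induct)
  case id
  have "restrict (\<lambda>p. p) (surface A B C D) ` slabs A B C D \<subseteq> slabs A B C D"
    using slabs_surface by auto
  then show ?case
    by (intro exI[of _ "slabs A B C D"] conjI connected_slabs slabs_subset_orbit order_refl)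
next
  case (move h)
  define k where "k = restrict h (surface A B C D)"
  have kG: "k \<in> aut_group A B C D" unfolding k_def by (rule aut_group_moves[OF move])
  obtain c where c: "c \<in> coordinates" "\<And>p. c (h p) = c p"
    using moves_preserve_coordinate[OF move] by blast
  obtain p where p: "p \<in> slab A B C D c" using slab_nonempty[OF c(1)] by blast
  then have "k p \<in> slab A B C D c"
    using c(2) moves_surface[OF move] by (auto simp: slab_def k_def)
  then have kp: "k p \<in> slabs A B C D" "p \<in> slabs A B C D"
    using p c(1) unfolding slabs_def by blast+
  have "k p \<in> slabs A B C D \<inter> k ` slabs A B C D"
    using kp(1) imageI[OF kp(2), of k] by (rule IntI)
  then have meet: "slabs A B C D \<inter> k ` slabs A B C D \<noteq> {}" by (metis empty_iff)
  have conn: "connected (k ` slabs A B C D)"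
    by (rule connected_continuous_image[OF continuous_on_subset[OF continuous_on_aut_group[OF kG] slabs_subset_surface] connected_slabs])
  have "k ` slabs A B C D \<subseteq> slab_orbit A B C D"
    unfolding slab_orbit_def by (rule UN_upper[OF kG])
  then have "slabs A B C D \<union> k ` slabs A B C D \<subseteq> slab_orbit A B C D"
    using slabs_subset_orbit by (intro Un_least)
  then show ?case
    unfolding k_def[symmetric] using connected_Un[OF connected_slabs conn meet] Un_upper1 Un_upper2 by metis
next
  case (compose g f)
  obtain T where T: "connected T" "slabs A B C D \<subseteq> T" "g ` slabs A B C D \<subseteq> T" "T \<subseteq> slab_orbit A B C D"
    using compose(3) by auto
  obtain T' where T': "connected T'" "slabs A B C D \<subseteq> T'" "f ` slabs A B C D \<subseteq> T'" "T' \<subseteq> slab_orbit A B C D"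
    using compose(4) by auto
  have "T' \<subseteq> surface A B C D"
    using T'(4) slab_orbit_subset_surface by (rule order_trans)
  then have conn: "connected (g ` T')"
    by (rule connected_continuous_image[OF continuous_on_subset[OF continuous_on_aut_group[OF compose(1)]] T'(1)])
  obtain q where q: "q \<in> slabs A B C D" using slabs_nonempty by blast
  \<comment> \<open>\<open>T\<close> links \<open>slabs\<close> to its image under \<open>g\<close>;
    the image of \<open>T'\<close> links that to the image under the product. The two links meet at
    \<open>g q\<close>.\<close>
  have "g q \<in> T \<inter> g ` T'"
    using subsetD[OF T(3) imageI[OF q]] imageI[OF subsetD[OF T'(2) q]] by (rule IntI)
  then have "T \<inter> g ` T' \<noteq> {}" by (metis empty_iff)
  then have "connected (T \<union> g ` T')"
    by (rule connected_Un[OF T(1) conn])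
  moreover have "compose (surface A B C D) g f ` slabs A B C D \<subseteq> T \<union> g ` T'"
  proof (rule image_subsetI)
    fix q assume q: "q \<in> slabs A B C D"
    have "f q \<in> T'" by (rule subsetD[OF T'(3) imageI[OF q]])
    then show "compose (surface A B C D) g f q \<in> T \<union> g ` T'"
      using slabs_surface[OF q] by (simp add: compose_def)
  qed
  moreover have "T \<union> g ` T' \<subseteq> slab_orbit A B C D"
    by (intro Un_least T(4) image_subsetI aut_group_slab_orbit[OF compose(1)] subsetD[OF T'(4)])
  moreover have "slabs A B C D \<subseteq> T \<union> g ` T'" using T(2) by (rule le_supI1)
  ultimately show ?case by (intro exI conjI)
qed

text \<open>All the chains contain the nonempty set \<open>slabs\<close>, so their union is
  connected.\<close>

lemma connected_slab_orbit: "connected (slab_orbit A B C D)"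
proof -
  let ?F = "{T. connected T \<and> slabs A B C D \<subseteq> T \<and> T \<subseteq> slab_orbit A B C D}"
  have "slab_orbit A B C D = \<Union>?F"
  proof
    show "slab_orbit A B C D \<subseteq> \<Union>?F"
    proof
      fix p assume "p \<in> slab_orbit A B C D"
      then obtain g where g: "g \<in> aut_group A B C D" "p \<in> g ` slabs A B C D"
        unfolding slab_orbit_def by blast
      then show "p \<in> \<Union>?F" using connected_chain[OF g(1)] by blast
    qed
  qed blast
  moreover have "connected (\<Union>?F)"
    using slabs_nonempty by (intro connected_Union) blast+
  ultimately show ?thesis by simp
qed

section \<open>The Julia set as the closure of the orbit\<close>

lemma slab_orbit_subset_julia: "slab_orbit A B C D \<subseteq> julia_set A B C D"
proof
  fix p assume "p \<in> slab_orbit A B C D"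
  then obtain g q c where g: "g \<in> aut_group A B C D" "p = g q" and q: "c \<in> coordinates" "q \<in> slab A B C D c"
    unfolding slab_orbit_def slabs_def by blast
  then obtain h k where "h \<in> moves A B C" "k \<in> moves A B C" "unstable_at (surface A B C D) h k q"
    using unstable_at_coordinate[of q A B C D c] by (auto simp: slab_def)
  then show "p \<in> julia_set A B C D"
    using julia_of_unstable[OF _ g(1)] q(2) g(2) by (auto simp: slab_def)
qed

lemma closed_julia_set: "closed (julia_set A B C D)"
proof -
  have "openin (top_of_set (surface A B C D)) (fatou_set A B C D)"
  proof (subst openin_subopen, intro ballI)
    fix p assume "p \<in> fatou_set A B C D"
    then obtain U where U: "openin (top_of_set (surface A B C D)) U" "p \<in> U"
      "normal_family_on (surface A B C D) (aut_group A B C D) U"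
      unfolding fatou_set_def by blast
    then have "U \<subseteq> fatou_set A B C D"
      using openin_imp_subset unfolding fatou_set_def by blast
    then show "\<exists>T. openin (top_of_set (surface A B C D)) T \<and> p \<in> T \<and> T \<subseteq> fatou_set A B C D"
      using U by blast
  qed
  then have "closedin (top_of_set (surface A B C D)) (julia_set A B C D)"
    unfolding julia_set_def by (metis closedin_diff closedin_topspace topspace_euclidean_subtopology)
  then show ?thesis using closed_surface closedin_closed_trans by blast
qed

text \<open>At a singular point the line \<open>(x, y + t, z + \<mu> t)\<close> lies in the surface and \<open>s_z \<circ> s_y\<close>
  multiplies \<open>t\<close> by \<open>\<mu>\<^sup>2\<close>, so points arbitrarily close to it reach \<open>y = 0\<close>.\<close>

lemma singular_in_closure:
  assumes p: "(x, y, z) \<in> surface A B C D"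
    and sing: "2 * x + y * z = A" "2 * y + x * z = B" "2 * z + x * y = C"
  shows "(x, y, z) \<in> closure (slab_orbit A B C D)"
proof (cases "x \<in> complex_of_real ` {-2..2}")
  case True
  then obtain s where s: "x = of_real s" "\<bar>s\<bar> \<le> 2" by auto
  show ?thesis
    unfolding closure_approachable
  proof (intro allI impI)
    fix e :: real assume "e > 0"
    then obtain d where d: "d > 0" "\<And>x' z'. dist x' x < d \<Longrightarrow> dist z' z < d \<Longrightarrow>
        \<exists>y'. dist y' y < e / 2 \<and> (x', y', z') \<in> surface A B C D"
      using surface_lift[OF p, of "e / 2"] by auto
    define \<delta> where "\<delta> = min (1 / 2) (min d e / 8)"
    have \<delta>: "\<delta> > 0" "\<delta> \<le> 1 / 2" "2 * \<delta> < d" "2 * \<delta> < e / 2"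
      using d(1) \<open>e > 0\<close> by (auto simp: \<delta>_def)
    \<comment> \<open>Shrinking towards 0 brings even the endpoints into the open interval; the lift
      then keeps the point on the surface.\<close>
    define s' where "s' = s * (1 - \<delta>)"
    have "\<bar>s'\<bar> = \<bar>s\<bar> * (1 - \<delta>)" using \<delta> by (simp add: s'_def abs_mult)
    also have "\<dots> \<le> 2 * (1 - \<delta>)" using s(2) \<delta> by (intro mult_right_mono) auto
    finally have s'2: "\<bar>s'\<bar> < 2" using \<delta>(1) by simp
    have "\<bar>s' - s\<bar> = \<bar>s\<bar> * \<delta>" using \<delta>(1) by (simp add: s'_def algebra_simps abs_mult)
    also have "\<dots> \<le> 2 * \<delta>" using s(2) \<delta> by (intro mult_right_mono) auto
    finally have ds: "dist (complex_of_real s') x \<le> 2 * \<delta>"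
      unfolding s(1) dist_of_real by (simp add: dist_real_def)
    then obtain y' where y': "dist y' y < e / 2" "(of_real s', y', z) \<in> surface A B C D"
      using d(1) d(2)[of "of_real s'" z] \<delta>(3) by auto
    have "s' \<in> {-2<..<2}" using s'2 by auto
    then have "(of_real s', y', z) \<in> slab A B C D fst"
      using y'(2) by (simp add: slab_def)
    then have "(of_real s', y', z) \<in> slab_orbit A B C D"
      using slabs_subset_orbit unfolding slabs_def coordinates_def by blast
    moreover have "dist (complex_of_real s', y', z) (x, y, z) < e"
    proof -
      have "dist (complex_of_real s', y', z) (x, y, z) \<le> dist (complex_of_real s') x + dist (y', z) (y, z)"
        unfolding dist_Pair_Pair[of "complex_of_real s'"] by (rule sqrt_sum_squares_le_sum) auto
      moreover have "dist (y', z) (y, z) = dist y' y" by (simp add: dist_Pair_Pair)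
      ultimately show ?thesis using ds y'(1) \<delta>(4) by linarith
    qed
    ultimately show "\<exists>w\<in>slab_orbit A B C D. dist w (x, y, z) < e" by blast
  qed
next
  case False
  then obtain \<mu> where \<mu>: "\<mu>^2 + x * \<mu> + 1 = 0" "norm \<mu> > 1" by (rule expanding_eigenvalue)
  then have "\<mu> \<noteq> 0" by auto
  define q where "q = (\<lambda>t. (x, y + t, z + \<mu> * t))"
  have x\<mu>: "x * \<mu> = - 1 - \<mu>^2" using \<mu>(1) by (simp add: algebra_simps eq_neg_iff_add_eq_0)
  have qS: "q t \<in> surface A B C D" for t
  proof -
    \<comment> \<open>The terms linear in \<open>t\<close> cancel by the singularity equations, and
      the choice of \<open>\<mu>\<close> kills the quadratic one.\<close>
    have "x^2 + (y + t)^2 + (z + \<mu> * t)^2 + x * (y + t) * (z + \<mu> * t) - (A * x + B * (y + t) + C * (z + \<mu> * t) + D) =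
      (x^2 + y^2 + z^2 + x * y * z - (A * x + B * y + C * z + D)) + (\<mu>^2 + x * \<mu> + 1) * t^2"
      unfolding sing(2,3)[symmetric] by (simp add: algebra_simps power2_eq_square)
    also have "\<dots> = 0" using p \<mu>(1) by (simp add: surface_def)
    finally show ?thesis by (simp add: q_def surface_def)
  qed
  have step: "s_z C (s_y B (q t)) = q (\<mu>^2 * t)" for t
  proof -
    have 1: "- (y + t) - x * (z + \<mu> * t) + B = y + \<mu>^2 * t"
      using x\<mu> unfolding sing(2)[symmetric] by algebra
    have 2: "- (z + \<mu> * t) - x * (y + \<mu>^2 * t) + C = z + \<mu> * (\<mu>^2 * t)"
      using x\<mu> unfolding sing(3)[symmetric] by algebra
    show ?thesis by (simp only: q_def s_y_def s_z_def prod.case 1 2)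
  qed
  have pow: "((s_z C \<circ> s_y B) ^^ n) (q t) = q ((\<mu>^2)^n * t)" for n t
    by (induction n) (simp_all add: step mult.assoc)
  \<comment> \<open>The parameter becomes \<open>- y\<close> after \<open>n\<close> steps, and there
    the middle coordinate is 0.\<close>
  define w where "w = (\<lambda>n. q (- y / (\<mu>^2)^n))"
  have "w n \<in> slab_orbit A B C D" for n
  proof (rule slab_orbit_of_image)
    have "s_z C \<circ> s_y B \<in> moves A B C" by (simp add: moves_def)
    then show "restrict ((s_z C \<circ> s_y B) ^^ n) (surface A B C D) \<in> aut_group A B C D"
      by (rule aut_group_moves_pow)
    show wS: "w n \<in> surface A B C D" by (simp add: w_def qS)
    have "((s_z C \<circ> s_y B) ^^ n) (w n) = q (- y)"
      unfolding w_def pow using \<open>\<mu> \<noteq> 0\<close> by simp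
    moreover have "q (- y) \<in> slabs A B C D"
      using qS[of "- y"] zero_in_interval unfolding slabs_def coordinates_def slab_def q_def by simp
    ultimately show "restrict ((s_z C \<circ> s_y B) ^^ n) (surface A B C D) (w n) \<in> slabs A B C D"
      using wS by simp
  qed
  moreover have "w \<longlonglongrightarrow> (x, y, z)"
  proof -
    have "norm (\<mu>^2) > 1" using one_less_power[OF \<mu>(2), of 2] by (simp add: norm_power)
    then have "(\<lambda>n. - y / (\<mu>^2)^n) \<longlonglongrightarrow> 0"
      by (intro tendsto_divide_0[OF tendsto_const] filterlim_realpow_sequentially_gt1)
    then have "(\<lambda>n. (x, y + (- y / (\<mu>^2)^n), z + \<mu> * (- y / (\<mu>^2)^n))) \<longlonglongrightarrow> (x, y + 0, z + \<mu> * 0)"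
      by (intro tendsto_intros)
    then show ?thesis by (simp add: w_def q_def)
  qed
  ultimately show ?thesis unfolding closure_sequential by blast
qed

lemma julia_subset_closure: "julia_set A B C D \<subseteq> closure (slab_orbit A B C D)"
proof
  fix p assume pJ: "p \<in> julia_set A B C D"
  then have pS: "p \<in> surface A B C D" by (simp add: julia_set_def)
  obtain x y z where p: "p = (x, y, z)" by (cases p)
  show "p \<in> closure (slab_orbit A B C D)"
  proof (rule ccontr)
    assume pn: "p \<notin> closure (slab_orbit A B C D)"
    let ?W = "- closure (slab_orbit A B C D)"
    have "2 * x + y * z \<noteq> A \<or> 2 * y + x * z \<noteq> B \<or> 2 * z + x * y \<noteq> C"
      using singular_in_closure pn pS unfolding p by blast
    then have "discs_near (surface A B C D) (surface A B C D \<inter> ?W) p"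
      using pS pn unfolding p by (intro discs_near_smooth) auto
    then have "p \<in> fatou_set A B C D"
    proof (rule fatou_setI[OF pS])
      fix g q c assume g: "g \<in> aut_group A B C D" and q: "q \<in> surface A B C D \<inter> ?W" and c: "c \<in> coordinates"
      \<comment> \<open>Otherwise the inverse of \<open>g\<close> would put \<open>q\<close> into
        the orbit.\<close>
      have "g q \<notin> slabs A B C D"
        using slab_orbit_of_image[OF g] q closure_subset by blast
      then show "c (g q) \<notin> {0, 1}"
        using c q aut_group_surface[OF g] zero_in_interval one_in_interval
        by (auto simp: slabs_def slab_def)
    qed
    then show False using pJ by (simp add: julia_set_def)
  qed
qed

theorem theoremC:
  fixes A B C D :: complex
  shows "connected (julia_set A B C D)"
proof -
  have "julia_set A B C D = closure (slab_orbit A B C D)"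
    using julia_subset_closure closure_minimal[OF slab_orbit_subset_julia closed_julia_set] by blast
  then show ?thesis by (simp add: connected_imp_connected_closure connected_slab_orbit)
qed

end
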